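(* Let $\mathcal{H},A,Q,\overline{s},F$ be as in the context, and for $h\in(0,1)$ let $(u_n)_{n\ge0},(\overline u_n)_{n\ge0}$ be defined by $$u_{n+1}=J_1\Big(u_n+hF\big(u_n+\tfrac12\sqrt hJ_2\xi_n^Q\big)+\tfrac{\sqrt2-1}{2}\sqrt hJ_2\xi_n^Q\Big)+\tfrac{3-\sqrt2}{2}\sqrt hJ_2\xi_n^Q,\qquad \overline u_n=u_n+\tfrac12\sqrt hJ_3\xi_n^Q ,$$ with deterministic initial value $u_0$. For all $s\in[0,\overline{s})$, assuming $u_0\in\mathcal{H}^s$, there exists a constant $C_s\in(0,+\infty)$ such that for all $h\in(0,1)$, $$\sup_{n\in\mathbb{N}}\mathbb{E}|u_n|_s\le C_s(1+|u_0|_s),\qquad \sup_{n\in\mathbb{N}}\mathbb{E}|\overline u_n|_s\le C_s(1+|u_0|_s).$$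
   Context: $\mathcal{H}$ is a separable infinite-dimensional Hilbert space with norm $|\cdot|$. $-A$ is an unbounded self-adjoint operator on $\mathcal{H}$ with eigenvalues $0<\lambda_1\le\lambda_2\le\cdots$, $\lambda_p\to+\infty$, and complete orthonormal eigenvectors $(e_p)_{p\ge1}$, $Ae_p=-\lambda_pe_p$. For $s\ge0$, $\mathcal{H}^s=\{u\in\mathcal{H}:|u|_s^2:=\sum_p\lambda_p^s|\langle u,e_p\rangle|^2<\infty\}$. $Q$ is a bounded non-negative self-adjoint operator with $Qe_p=q_pe_p$, $(q_p)$ a bounded sequence of non-negative reals. The standing trace condition is $\overline{s}=\sup\{s\in(0,1):\mathrm{Trace}((-A)^{-1+s}Q)<+\infty\}>0$. $F:\mathcal{H}\to\mathcal{H}$ is Lipschitz continuous with constant $L=\sup_{u^1\ne u^2}\frac{|F(u^1)-F(u^2)|}{|u^1-u^2|}<\lambda_1$ (no gradient structure of $F$ is required). $W^Q(t)=\sum_{p\ge1}\sqrt{q_p}\,\beta_p(t)e_p$ with $(\beta_p)$ independent standard scalar Wiener processes. For a timestep $h>0$: $\xi_n^Q=h^{-1/2}(W^Q((n+1)h)-W^Q(nh))$, $J_1=(I-hA)^{-1}$, $J_2=(I-\frac{3-\sqrt2}{2}hA)^{-1}$, and $J_3$ satisfies $J_3QJ_3^T=(I-\frac h2A)^{-1}Q$ (e.g. $J_3=(I-\frac h2A)^{-1/2}$). *)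

theory Defs
  imports "HOL-Probability.Probability"
begin

(* Throughout, the Hilbert space is a type of class {real_inner, polish_space}, i.e. a complete and
   separable real inner product space; an orthonormal sequence indexed by nat makes it
   infinite-dimensional. Sequences indexed by p >= 1 in the mathematics are indexed from 0 here. *)

(* An unbounded operator is a total function T together with its domain D; values of T outside D
   are irrelevant. The last conjunct says that the graph of the adjoint of (D, T) is the graph
   of (D, T) itself. *)
definition self_adjoint_on :: "'a::real_inner set \<Rightarrow> ('a \<Rightarrow> 'a) \<Rightarrow> bool" where
  "self_adjoint_on D T \<longleftrightarrow>
     subspace D \<and> closure D = UNIV \<and>
     (\<forall>x\<in>D. \<forall>y\<in>D. T (x + y) = T x + T y) \<and>
     (\<forall>c. \<forall>x\<in>D. T (c *\<^sub>R x) = c *\<^sub>R T x) \<and>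
     {(y, z). \<forall>x\<in>D. T x \<bullet> y = x \<bullet> z} = {(y, T y) | y. y \<in> D}"

definition complete_orthonormal :: "(nat \<Rightarrow> 'a::real_inner) \<Rightarrow> bool" where
  "complete_orthonormal e \<longleftrightarrow>
     (\<forall>i j. e i \<bullet> e j = (if i = j then 1 else 0)) \<and> closure (span (range e)) = UNIV"

(* (I - c A)^{-1} *)
definition resolvent :: "'a::real_vector set \<Rightarrow> ('a \<Rightarrow> 'a) \<Rightarrow> real \<Rightarrow> 'a \<Rightarrow> 'a" where
  "resolvent D A c = the_inv_into D (\<lambda>y. y - c *\<^sub>R A y)"

(* (-A)^r by functional calculus, when -A has eigenvalues lam with eigenvectors e. It is only used
   with r < 0 and lam bounded away from 0, where it is an everywhere defined bounded operator. *)
definition frac_power :: "(nat \<Rightarrow> real) \<Rightarrow> (nat \<Rightarrow> 'a::real_inner) \<Rightarrow> real \<Rightarrow> 'a \<Rightarrow> 'a" where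
  "frac_power lam e r x = (\<Sum>p. (lam p powr r * (x \<bullet> e p)) *\<^sub>R e p)"

(* Trace of a non-negative operator, possibly infinite, computed in the orthonormal basis e. *)
definition op_trace :: "(nat \<Rightarrow> 'a::real_inner) \<Rightarrow> ('a \<Rightarrow> 'a) \<Rightarrow> ennreal" where
  "op_trace e T = (\<Sum>p. ennreal (T (e p) \<bullet> e p))"

(* As a supremum in the extended reals, it is -\<infinity> when no exponent in (0,1) is admissible. *)
definition s_bar :: "(nat \<Rightarrow> real) \<Rightarrow> (nat \<Rightarrow> 'a::real_inner) \<Rightarrow> ('a \<Rightarrow> 'a) \<Rightarrow> ereal" where
  "s_bar lam e Q =
     Sup (ereal ` {s. 0 < s \<and> s < 1 \<and> op_trace e (\<lambda>x. frac_power lam e (-1 + s) (Q x)) < \<infinity>})"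

definition H_space :: "(nat \<Rightarrow> real) \<Rightarrow> (nat \<Rightarrow> 'a::real_inner) \<Rightarrow> real \<Rightarrow> 'a set" where
  "H_space lam e s = {u. summable (\<lambda>p. lam p powr s * \<bar>u \<bullet> e p\<bar>\<^sup>2)}"

(* The norm of H^s, extended by \<infinity> outside H^s, so that a finite expectation of the norm of a
   random variable includes the claim that it takes values in H^s almost surely. *)
definition H_norm :: "(nat \<Rightarrow> real) \<Rightarrow> (nat \<Rightarrow> 'a::real_inner) \<Rightarrow> real \<Rightarrow> 'a \<Rightarrow> ennreal" where
  "H_norm lam e s u =
     (if u \<in> H_space lam e s then ennreal (sqrt (\<Sum>p. lam p powr s * \<bar>u \<bullet> e p\<bar>\<^sup>2)) else \<infinity>)"

definition lipschitz_const :: "('a::real_normed_vector \<Rightarrow> 'a) \<Rightarrow> real" where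
  "lipschitz_const F = Sup {norm (F x - F y) / norm (x - y) | x y. x \<noteq> y}"

definition wiener_process :: "'w measure \<Rightarrow> (real \<Rightarrow> 'w \<Rightarrow> real) \<Rightarrow> bool" where
  "wiener_process M B \<longleftrightarrow>
     (\<forall>t\<ge>0. B t \<in> borel_measurable M) \<and>
     (AE \<omega> in M. B 0 \<omega> = 0) \<and>
     (AE \<omega> in M. continuous_on {0..} (\<lambda>t. B t \<omega>)) \<and>
     (\<forall>s t. 0 \<le> s \<longrightarrow> s < t \<longrightarrow>
        distributed M lborel (\<lambda>\<omega>. B t \<omega> - B s \<omega>) (\<lambda>x. ennreal (normal_density 0 (sqrt (t - s)) x))) \<and>
     (\<forall>t::nat \<Rightarrow> real. 0 \<le> t 0 \<longrightarrow> incseq t \<longrightarrow>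
        prob_space.indep_vars M (\<lambda>_. borel) (\<lambda>i \<omega>. B (t (Suc i)) \<omega> - B (t i) \<omega>) UNIV)"

definition independent_wiener_processes ::
    "'w measure \<Rightarrow> (nat \<Rightarrow> real \<Rightarrow> 'w \<Rightarrow> real) \<Rightarrow> bool" where
  "independent_wiener_processes M \<beta> \<longleftrightarrow>
     (\<forall>p. wiener_process M (\<beta> p)) \<and>
     prob_space.indep_vars M (\<lambda>_. PiM {0..} (\<lambda>_. borel)) (\<lambda>p \<omega>. \<lambda>t\<in>{0..}. \<beta> p t \<omega>) UNIV"

(* Q need not be trace class, so the series W^Q(t) = \<Sum>p. sqrt(q_p) \<beta>_p(t) e_p need not converge
   in the Hilbert space. Its partial sums and their increments xi_n^Q are meaningful, and for a
   bounded operator J the random variable J xi_n^Q is the limit in L^2(M; H) of the images of these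
   partial sums. The limit is unique up to null sets; the choice of a version is immaterial. *)
definition WQ_partial ::
    "(nat \<Rightarrow> real) \<Rightarrow> (nat \<Rightarrow> 'a::real_inner) \<Rightarrow> (nat \<Rightarrow> real \<Rightarrow> 'w \<Rightarrow> real) \<Rightarrow> nat \<Rightarrow> real \<Rightarrow> 'w \<Rightarrow> 'a" where
  "WQ_partial q e \<beta> N t \<omega> = (\<Sum>p<N. (sqrt (q p) * \<beta> p t \<omega>) *\<^sub>R e p)"

definition xi_partial ::
    "(nat \<Rightarrow> real) \<Rightarrow> (nat \<Rightarrow> 'a::real_inner) \<Rightarrow> (nat \<Rightarrow> real \<Rightarrow> 'w \<Rightarrow> real) \<Rightarrow> real \<Rightarrow> nat \<Rightarrow> nat \<Rightarrow> 'w \<Rightarrow> 'a" where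
  "xi_partial q e \<beta> h n N \<omega> =
     (1 / sqrt h) *\<^sub>R (WQ_partial q e \<beta> N ((real n + 1) * h) \<omega> - WQ_partial q e \<beta> N (real n * h) \<omega>)"

definition apply_xi ::
    "'w measure \<Rightarrow> (nat \<Rightarrow> real) \<Rightarrow> (nat \<Rightarrow> 'a::real_inner) \<Rightarrow> (nat \<Rightarrow> real \<Rightarrow> 'w \<Rightarrow> real) \<Rightarrow>
     ('a \<Rightarrow> 'a) \<Rightarrow> real \<Rightarrow> nat \<Rightarrow> 'w \<Rightarrow> 'a" where
  "apply_xi M q e \<beta> J h n =
     (SOME X. X \<in> borel_measurable M \<and>
        (\<lambda>N. \<integral>\<^sup>+ \<omega>. ennreal ((norm (X \<omega> - J (xi_partial q e \<beta> h n N \<omega>)))\<^sup>2) \<partial>M) \<longlonglongrightarrow> 0)"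

(* J2xi n stands for J_2 xi_n^Q *)
primrec scheme ::
    "('a::real_normed_vector \<Rightarrow> 'a) \<Rightarrow> ('a \<Rightarrow> 'a) \<Rightarrow> (nat \<Rightarrow> 'w \<Rightarrow> 'a) \<Rightarrow> real \<Rightarrow> 'a \<Rightarrow> nat \<Rightarrow> 'w \<Rightarrow> 'a" where
  "scheme F J1 J2xi h u0 0 \<omega> = u0"
| "scheme F J1 J2xi h u0 (Suc n) \<omega> =
     J1 (scheme F J1 J2xi h u0 n \<omega>
         + h *\<^sub>R F (scheme F J1 J2xi h u0 n \<omega> + (1/2 * sqrt h) *\<^sub>R J2xi n \<omega>)
         + ((sqrt 2 - 1) / 2 * sqrt h) *\<^sub>R J2xi n \<omega>)
     + ((3 - sqrt 2) / 2 * sqrt h) *\<^sub>R J2xi n \<omega>"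

end

theory Submission
  imports Defs
begin

text \<open>
The idea is to split off the noise. Let \<open>z\<^sub>n\<close> be the scheme with zero drift and zero initial value,
driven by the same noise, and put \<open>v\<^sub>n = u\<^sub>n - z\<^sub>n\<close>. All estimates are for second moments, which
grow quadratically in \<open>|u\<^sub>0|\<^sub>s\<close>; Young's inequality with parameter \<open>1 + |u\<^sub>0|\<^sub>s\<close> turns them into linear
bounds on first moments (\<open>H_norm_le_sobolev_sq\<close>).

The process \<open>z\<^sub>n\<close> is diagonal in the eigenbasis. The coefficients of the scheme are such that both
injections of noise combine to \<open>J\<^sub>1\<close>, so each coordinate of \<open>z\<^sub>n\<close> is a weighted geometric sum of orthonormal
Gaussian increments, with variance at most \<open>q\<^sub>p / (2 \<lambda>\<^sub>p)\<close> whatever \<open>n\<close> and \<open>h\<close> are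
(\<open>stochastic_convolution_second_moment\<close>). Multiplying by \<open>\<lambda>\<^sub>p\<^sup>s\<close> and summing gives half the trace of
\<open>(-A)\<^sup>s\<^sup>-\<^sup>1 Q\<close>, which is finite for \<open>s\<close> below the critical exponent. The noise inside the drift and the
noise of the postprocessing obey bounds of the same form; for the latter only the covariance of \<open>J\<^sub>3 \<xi>\<close> is
known, and \<open>covariance_coordinates\<close> reads the variances of the coordinates off it.

The process \<open>v\<^sub>n\<close> satisfies \<open>v\<^sub>n\<^sub>+\<^sub>1 = J\<^sub>1 (v\<^sub>n + h F(v\<^sub>n + w\<^sub>n))\<close>, where the shift \<open>w\<^sub>n\<close> has bounded second moments. In
the norm of the Hilbert space the resolvent contracts by \<open>1 + h \<lambda>\<^sub>1\<close> while the drift expands by at most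
\<open>1 + h L\<close>; as \<open>L < \<lambda>\<^sub>1\<close>, second moments stay bounded, uniformly in \<open>n\<close> and \<open>h\<close>
(\<open>remainder_norm_moment\<close>). Hence the drift has bounded second moments, and as the implicit step gains
up to one order of the scale \<open>H\<^sup>s\<close> on the drift, the bound lifts to \<open>H\<^sup>s\<close> for \<open>s \<le> 1\<close> (\<open>resolvent_step_sobolev\<close>,
\<open>remainder_sobolev_moment\<close>).

Some foundations come first: expansions in the eigenbasis, the diagonal form of the resolvent of a
self-adjoint operator with a complete set of eigenvectors, and the existence of the mean-square limits
that define the images of the cylindrical noise.
\<close>

section \<open>Expansions in a complete orthonormal sequence\<close>

locale complete_orthonormal_sequence =
  fixes e :: "nat \<Rightarrow> 'a::{real_inner, polish_space}"
  assumes complete_orthonormal: "complete_orthonormal e"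
begin

lemma inner_basis: "e i \<bullet> e j = (if i = j then 1 else 0)"
  using complete_orthonormal by (auto simp: complete_orthonormal_def)

lemma inner_sum_basis: "finite I \<Longrightarrow> (\<Sum>p\<in>I. c p *\<^sub>R e p) \<bullet> e k = (if k \<in> I then c k else 0)"
  by (simp add: inner_sum_left inner_basis if_distrib sum.delta cong: if_cong)

lemma norm_sum_basis: "finite I \<Longrightarrow> (norm (\<Sum>p\<in>I. c p *\<^sub>R e p))\<^sup>2 = (\<Sum>p\<in>I. (c p)\<^sup>2)"
  unfolding power2_norm_eq_inner inner_sum_right inner_scaleR_right
  by (intro sum.cong) (auto simp: inner_sum_basis power2_eq_square)

lemma norm_partial_expansion_le: "norm (\<Sum>p<N. (x \<bullet> e p) *\<^sub>R e p) \<le> norm x"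
proof -
  let ?P = "\<Sum>p<N. (x \<bullet> e p) *\<^sub>R e p"
  have "x \<bullet> ?P = (\<Sum>p<N. (x \<bullet> e p)\<^sup>2)"
    by (simp add: inner_sum_right power2_eq_square)
  then have "(norm ?P)\<^sup>2 = x \<bullet> ?P"
    by (simp add: norm_sum_basis)
  also have "\<dots> \<le> norm x * norm ?P"
    by (rule norm_cauchy_schwarz)
  finally show ?thesis
    by (cases "norm ?P = 0") (auto simp: power2_eq_square)
qed

text \<open>On finite linear combinations of the basis the expansion is a finite sum. This is the dense set
on which convergence of the expansion is trivial.\<close>

lemma partial_expansion_eventually_eq:
  assumes "y \<in> span (range e)"
  shows "\<exists>N. \<forall>n\<ge>N. (\<Sum>p<n. (y \<bullet> e p) *\<^sub>R e p) = y"
  using assms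
proof (induction rule: span_induct_alt)
  case base
  then show ?case by simp
next
  case (step c x y)
  then obtain k N where k: "x = e k" and N: "\<forall>n\<ge>N. (\<Sum>p<n. (y \<bullet> e p) *\<^sub>R e p) = y"
    by auto
  have "(\<Sum>p<n. ((c *\<^sub>R x + y) \<bullet> e p) *\<^sub>R e p) = c *\<^sub>R x + y" if "n \<ge> max N (Suc k)" for n
  proof -
    have "(\<Sum>p<n. (e k \<bullet> e p) *\<^sub>R e p) = (\<Sum>p<n. if p = k then e p else 0)"
      by (intro sum.cong) (auto simp: inner_basis)
    also have "\<dots> = e k"
      using that by (simp add: sum.delta)
    finally have "(\<Sum>p<n. (e k \<bullet> e p) *\<^sub>R e p) = e k" .
    moreover have "(\<Sum>p<n. ((c *\<^sub>R x + y) \<bullet> e p) *\<^sub>R e p)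
        = c *\<^sub>R (\<Sum>p<n. (e k \<bullet> e p) *\<^sub>R e p) + (\<Sum>p<n. (y \<bullet> e p) *\<^sub>R e p)"
      by (simp add: k inner_add_left scaleR_add_left sum.distrib scaleR_sum_right)
    ultimately show ?thesis
      using N that by (simp add: k)
  qed
  then show ?case by blast
qed

text \<open>Convergence passes from the dense span to the whole space because the partial expansions are
contractions.\<close>

lemma expansion: "(\<lambda>N. \<Sum>p<N. (x \<bullet> e p) *\<^sub>R e p) \<longlonglongrightarrow> x"
proof (rule LIMSEQ_I)
  fix r :: real assume r: "0 < r"
  have "x \<in> closure (span (range e))"
    using complete_orthonormal by (auto simp: complete_orthonormal_def)
  then obtain y where y: "y \<in> span (range e)" "dist y x < r / 2"
    using r half_gt_zero unfolding closure_approachable by blast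
  obtain N where N: "\<forall>n\<ge>N. (\<Sum>p<n. (y \<bullet> e p) *\<^sub>R e p) = y"
    using partial_expansion_eventually_eq[OF y(1)] by blast
  have "norm ((\<Sum>p<n. (x \<bullet> e p) *\<^sub>R e p) - x) < r" if "n \<ge> N" for n
  proof -
    have "(\<Sum>p<n. (x \<bullet> e p) *\<^sub>R e p) - x = (\<Sum>p<n. ((x - y) \<bullet> e p) *\<^sub>R e p) - (x - y)"
      using N that by (simp add: inner_diff_left scaleR_diff_left sum_subtractf)
    also have "norm \<dots> \<le> norm (x - y) + norm (x - y)"
      using norm_triangle_ineq4[of "\<Sum>p<n. ((x - y) \<bullet> e p) *\<^sub>R e p" "x - y"]
        norm_partial_expansion_le[of "x - y" n] by linarith
    also have "\<dots> < r"
      using y(2) by (simp add: dist_norm norm_minus_commute)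
    finally show ?thesis .
  qed
  then show "\<exists>no. \<forall>n\<ge>no. norm ((\<Sum>p<n. (x \<bullet> e p) *\<^sub>R e p) - x) < r" by blast
qed

lemma inner_sums: "(\<lambda>p. (x \<bullet> e p) * (y \<bullet> e p)) sums (x \<bullet> y)"
proof -
  have "(\<lambda>N. (\<Sum>p<N. (x \<bullet> e p) *\<^sub>R e p) \<bullet> y) \<longlonglongrightarrow> x \<bullet> y"
    by (intro tendsto_inner expansion tendsto_const)
  then show ?thesis
    by (simp add: sums_def inner_sum_left inner_commute[of y])
qed

lemma norm_sums: "(\<lambda>p. (x \<bullet> e p)\<^sup>2) sums (norm x)\<^sup>2"
  using inner_sums[of x x] by (simp add: power2_eq_square power2_norm_eq_inner[symmetric])

lemma eq_if_coordinates_eq: "(\<And>p. x \<bullet> e p = y \<bullet> e p) \<Longrightarrow> x = y"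
  using LIMSEQ_unique[OF expansion[of x]] expansion[of y] by simp

text \<open>The Riesz--Fischer direction of the isometry with the square-summable sequences; this is where
completeness of the space enters.\<close>

lemma exists_with_coordinates:
  assumes "summable (\<lambda>p. (c p)\<^sup>2)"
  shows "\<exists>x. \<forall>p. x \<bullet> e p = c p"
proof -
  let ?S = "\<lambda>N. \<Sum>p<N. c p *\<^sub>R e p"
  have "Cauchy ?S"
  proof (rule metric_CauchyI)
    fix r :: real assume r: "0 < r"
    obtain N where N: "\<And>m n. m \<ge> N \<Longrightarrow> norm (\<Sum>p=m..<n. (c p)\<^sup>2) < r\<^sup>2"
      using assms[unfolded summable_Cauchy, rule_format, of "r\<^sup>2"] r by auto
    have less: "dist (?S m) (?S n) < r" if "m \<ge> N" "n \<ge> m" for m n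
    proof -
      have "?S n - ?S m = (\<Sum>p=m..<n. c p *\<^sub>R e p)"
        using that(2) sum_diff_nat_ivl[of 0 m n "\<lambda>p. c p *\<^sub>R e p"] by (simp add: lessThan_atLeast0)
      then have "(norm (?S n - ?S m))\<^sup>2 < r\<^sup>2"
        using N[OF that(1), of n] by (simp add: norm_sum_basis)
      then show ?thesis
        using power_less_imp_less_base[of "norm (?S n - ?S m)" 2 r] r
        by (simp add: dist_norm norm_minus_commute)
    qed
    have "dist (?S m) (?S n) < r" if "m \<ge> N" "n \<ge> N" for m n
      using less[of m n] less[of n m] that by (cases "m \<le> n") (auto simp: dist_commute)
    then show "\<exists>M. \<forall>m\<ge>M. \<forall>n\<ge>M. dist (?S m) (?S n) < r" by blast
  qed
  then obtain x where x: "?S \<longlonglongrightarrow> x"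
    using Cauchy_convergent convergent_def by blast
  have "x \<bullet> e k = c k" for k
  proof (rule LIMSEQ_unique)
    show "(\<lambda>N. ?S N \<bullet> e k) \<longlonglongrightarrow> x \<bullet> e k"
      by (intro tendsto_inner x tendsto_const)
    show "(\<lambda>N. ?S N \<bullet> e k) \<longlonglongrightarrow> c k"
      by (rule tendsto_eventually, rule eventually_sequentiallyI[of "Suc k"]) (simp add: inner_sum_basis)
  qed
  then show ?thesis by blast
qed

text \<open>The library function \<open>adjoint\<close> selects some map with the adjoint property, so the existence of
such a map has to be proved. In coordinates it is forced to send \<open>y\<close> to the vector with
coordinates \<open>T (e p) \<bullet> y\<close>, and these are square summable because a partial sum of their squares
equals \<open>T w \<bullet> y\<close> for a vector \<open>w\<close> whose squared norm is that same partial sum.\<close>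

lemma adjoint_inner:
  fixes T :: "'a \<Rightarrow> 'a"
  assumes "bounded_linear T"
  shows "x \<bullet> adjoint T y = T x \<bullet> y"
proof -
  interpret T: bounded_linear T by fact
  obtain K where K: "\<And>x. norm (T x) \<le> norm x * K" "K > 0"
    using T.pos_bounded by blast
  have ex: "\<exists>z. \<forall>x. T x \<bullet> y = x \<bullet> z" for y
  proof -
    have bound: "(\<Sum>p<N. (T (e p) \<bullet> y)\<^sup>2) \<le> (K * norm y)\<^sup>2" for N
    proof -
      let ?w = "\<Sum>p<N. (T (e p) \<bullet> y) *\<^sub>R e p"
      have w: "(\<Sum>p<N. (T (e p) \<bullet> y)\<^sup>2) = (norm ?w)\<^sup>2"
        by (simp add: norm_sum_basis)
      also have "(norm ?w)\<^sup>2 = T ?w \<bullet> y"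
        unfolding w[symmetric] by (simp add: T.sum T.scaleR inner_sum_left power2_eq_square)
      also have "\<dots> \<le> norm ?w * K * norm y"
        using norm_cauchy_schwarz[of "T ?w" y] mult_right_mono[OF K(1)[of ?w], of "norm y"] by simp
      finally have *: "(norm ?w)\<^sup>2 \<le> norm ?w * K * norm y"
        unfolding w .
      have "norm ?w \<le> K * norm y"
        using * K(2) by (cases "norm ?w = 0") (auto simp: power2_eq_square)
      then have "(norm ?w)\<^sup>2 \<le> (K * norm y)\<^sup>2"
        by (intro power_mono) auto
      then show ?thesis using w by simp
    qed
    have "summable (\<lambda>p. (T (e p) \<bullet> y)\<^sup>2)"
    proof (rule bounded_imp_summable)
      show "(\<Sum>p\<le>N. (T (e p) \<bullet> y)\<^sup>2) \<le> (K * norm y)\<^sup>2" for N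
        using bound[of "Suc N"] by (simp only: lessThan_Suc_atMost)
    qed simp
    then obtain z where z: "\<And>p. z \<bullet> e p = T (e p) \<bullet> y"
      using exists_with_coordinates[of "\<lambda>p. T (e p) \<bullet> y"] by blast
    have "T x \<bullet> y = x \<bullet> z" for x
    proof (rule LIMSEQ_unique)
      show "(\<lambda>N. T (\<Sum>p<N. (x \<bullet> e p) *\<^sub>R e p) \<bullet> y) \<longlonglongrightarrow> T x \<bullet> y"
        by (intro tendsto_inner T.tendsto expansion tendsto_const)
      show "(\<lambda>N. T (\<Sum>p<N. (x \<bullet> e p) *\<^sub>R e p) \<bullet> y) \<longlonglongrightarrow> x \<bullet> z"
        using inner_sums[of x z] by (simp add: sums_def T.sum T.scaleR inner_sum_left z)
    qed
    then show ?thesis by blast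
  qed
  then obtain f where "\<forall>x y. T x \<bullet> y = x \<bullet> f y" by metis
  then have "\<forall>x y. T x \<bullet> y = x \<bullet> adjoint T y"
    unfolding adjoint_def by (rule someI[where P="\<lambda>f'. \<forall>x y. T x \<bullet> y = x \<bullet> f' y"])
  then show ?thesis by simp
qed

end

section \<open>Sobolev norms\<close>

lemma square_sum_le: "(a + b)\<^sup>2 \<le> 2 * a\<^sup>2 + 2 * b\<^sup>2" for a b :: real
  using zero_le_power2[of "a - b"] by (simp add: power2_eq_square algebra_simps)

text \<open>The square of the norm of \<open>H\<^sup>s\<close>, infinite outside \<open>H\<^sup>s\<close>. With values in the extended non-negative
reals, its expectation can be computed term by term without any integrability question.\<close>

definition sobolev_sq :: "(nat \<Rightarrow> real) \<Rightarrow> (nat \<Rightarrow> 'a::real_inner) \<Rightarrow> real \<Rightarrow> 'a \<Rightarrow> ennreal" where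
  "sobolev_sq lam e s x = (\<Sum>p. ennreal (lam p powr s * (x \<bullet> e p)\<^sup>2))"

lemma sobolev_sq_measurable [measurable]:
  "sobolev_sq lam e s \<in> borel_measurable (borel :: 'a::{real_inner, polish_space} measure)"
  unfolding sobolev_sq_def by measurable

lemma sobolev_sq_add_le:
  "sobolev_sq lam e s (x + y) \<le> 2 * sobolev_sq lam e s x + 2 * sobolev_sq lam e s y"
proof -
  have "lam p powr s * ((x + y) \<bullet> e p)\<^sup>2
      \<le> 2 * (lam p powr s * (x \<bullet> e p)\<^sup>2) + 2 * (lam p powr s * (y \<bullet> e p)\<^sup>2)" for p
    using mult_left_mono[of "((x + y) \<bullet> e p)\<^sup>2" "2 * (x \<bullet> e p)\<^sup>2 + 2 * (y \<bullet> e p)\<^sup>2" "lam p powr s"]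
      square_sum_le[of "x \<bullet> e p" "y \<bullet> e p"]
    by (simp add: inner_add_left algebra_simps)
  then have "ennreal (lam p powr s * ((x + y) \<bullet> e p)\<^sup>2)
      \<le> 2 * ennreal (lam p powr s * (x \<bullet> e p)\<^sup>2) + 2 * ennreal (lam p powr s * (y \<bullet> e p)\<^sup>2)" for p
    by (subst (1 2) ennreal_numeral[symmetric])
      (simp add: ennreal_mult[symmetric] ennreal_plus[symmetric] ennreal_leI del: ennreal_numeral ennreal_plus)
  then have "sobolev_sq lam e s (x + y)
      \<le> (\<Sum>p. 2 * ennreal (lam p powr s * (x \<bullet> e p)\<^sup>2) + 2 * ennreal (lam p powr s * (y \<bullet> e p)\<^sup>2))"
    unfolding sobolev_sq_def by (intro suminf_le summableI)
  also have "\<dots> = 2 * sobolev_sq lam e s x + 2 * sobolev_sq lam e s y"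
    unfolding sobolev_sq_def by (subst suminf_add[symmetric]) (auto intro: summableI)
  finally show ?thesis .
qed

text \<open>Young's inequality. For \<open>K\<close> of the size of \<open>1 + |u\<^sub>0|\<^sub>s\<close> it turns a bound on the second moment
that is quadratic in \<open>K\<close> into a bound on the first moment that is linear in \<open>K\<close>.\<close>

lemma H_norm_le_sobolev_sq:
  assumes "0 < K"
  shows "H_norm lam e s x \<le> ennreal K + ennreal (1 / K) * sobolev_sq lam e s x"
proof (cases "x \<in> H_space lam e s")
  case True
  let ?r = "\<Sum>p. lam p powr s * (x \<bullet> e p)\<^sup>2"
  have r: "sobolev_sq lam e s x = ennreal ?r" "0 \<le> ?r"
    using True unfolding sobolev_sq_def H_space_def
    by (auto intro!: suminf_ennreal2 suminf_nonneg)
  have "t \<le> K + 1 / K * t\<^sup>2" if "0 \<le> t" for t :: real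
  proof -
    have "K * t \<le> K * K + t\<^sup>2"
    proof -
      have "0 \<le> K * t"
        using assms that by simp
      moreover have "2 * (K * t) \<le> K * K + t\<^sup>2"
        using zero_le_power2[of "K - t"] by (simp add: power2_eq_square algebra_simps)
      ultimately show ?thesis by linarith
    qed
    then show ?thesis
      using assms by (simp add: field_simps power2_eq_square)
  qed
  from this[OF real_sqrt_ge_zero[OF r(2)]] have "sqrt ?r \<le> K + 1 / K * ?r"
    unfolding real_sqrt_pow2[OF r(2)] .
  then have "ennreal (sqrt ?r) \<le> ennreal (K + 1 / K * ?r)"
    by (rule ennreal_leI)
  also have "\<dots> = ennreal K + ennreal (1 / K) * ennreal ?r"
    using assms r(2) by (subst ennreal_plus) (auto simp: ennreal_mult simp del: times_divide_eq_left)
  finally show ?thesis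
    using True r(1) by (simp add: H_norm_def)
next
  case False
  then have "sobolev_sq lam e s x = \<top>"
    using summable_suminf_not_top[of "\<lambda>p. lam p powr s * (x \<bullet> e p)\<^sup>2"]
    unfolding sobolev_sq_def H_space_def by (simp del: suminf_ennreal) blast
  then show ?thesis
    using assms by (simp add: ennreal_mult_top)
qed

lemma sobolev_sq_of_H_space:
  assumes "x \<in> H_space lam e s"
  obtains r where "0 \<le> r" "H_norm lam e s x = ennreal r" "sobolev_sq lam e s x = ennreal (r\<^sup>2)"
proof
  let ?r = "\<Sum>p. lam p powr s * (x \<bullet> e p)\<^sup>2"
  have r: "0 \<le> ?r"
    using assms unfolding H_space_def by (auto intro!: suminf_nonneg)
  show "0 \<le> sqrt ?r" "H_norm lam e s x = ennreal (sqrt ?r)"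
    using assms r by (simp_all add: H_norm_def)
  have "sobolev_sq lam e s x = ennreal ?r"
    using assms unfolding sobolev_sq_def H_space_def by (auto intro!: suminf_ennreal2)
  then show "sobolev_sq lam e s x = ennreal ((sqrt ?r)\<^sup>2)"
    using r by simp
qed

lemma ennreal_suminf_swap:
  "(\<Sum>i. \<Sum>j. f i j) = (\<Sum>j. \<Sum>i. f i j)" for f :: "nat \<Rightarrow> nat \<Rightarrow> ennreal"
  using nn_integral_suminf[of "\<lambda>j i. f i j" "count_space UNIV"]
  by (simp add: nn_integral_count_space_nat)

section \<open>Self-adjoint operators with a complete set of eigenvectors\<close>

locale negative_diagonal_operator = complete_orthonormal_sequence e
  for e :: "nat \<Rightarrow> 'a::{real_inner, polish_space}" +
  fixes D :: "'a set" and A :: "'a \<Rightarrow> 'a" and lam :: "nat \<Rightarrow> real"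
  assumes self_adjoint: "self_adjoint_on D (\<lambda>x. - A x)"
    and basis_mem: "\<And>p. e p \<in> D"
    and A_basis: "\<And>p. A (e p) = - lam p *\<^sub>R e p"
    and lam_0_pos: "0 < lam 0" and lam_mono: "incseq lam"
begin

lemma lam_0_le: "lam 0 \<le> lam p"
  using lam_mono by (simp add: incseq_def)

lemma lam_pos: "0 < lam p"
  using lam_0_le[of p] lam_0_pos by simp

lemma graph: "{(y, z). \<forall>x\<in>D. - A x \<bullet> y = x \<bullet> z} = {(y, - A y) | y. y \<in> D}"
  using self_adjoint by (simp add: self_adjoint_on_def)

lemma A_coordinate:
  assumes "w \<in> D"
  shows "A w \<bullet> e p = - lam p * (w \<bullet> e p)"
proof -
  have "(e p, - A (e p)) \<in> {(y, z). \<forall>x\<in>D. - A x \<bullet> y = x \<bullet> z}"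
    unfolding graph using basis_mem by blast
  then show ?thesis
    using assms by (auto simp: A_basis)
qed

text \<open>The domain of a self-adjoint operator is as large as the eigenvalues permit: the symmetry
identity for the pair \<open>(y, z)\<close> holds coordinate by coordinate, and self-adjointness then puts the
pair into the graph.\<close>

lemma mem_domain_if_coordinates:
  assumes "\<And>p. z \<bullet> e p = lam p * (y \<bullet> e p)"
  shows "y \<in> D" "A y = - z"
proof -
  have "- A w \<bullet> y = w \<bullet> z" if "w \<in> D" for w
  proof (rule sums_unique2)
    show "(\<lambda>p. (- A w \<bullet> e p) * (y \<bullet> e p)) sums (- A w \<bullet> y)"
      by (rule inner_sums)
    show "(\<lambda>p. (- A w \<bullet> e p) * (y \<bullet> e p)) sums (w \<bullet> z)"
      using inner_sums[of w z] that by (simp add: A_coordinate assms ac_simps)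
  qed
  then have "(y, z) \<in> {(y, - A y) | y. y \<in> D}"
    unfolding graph[symmetric] by blast
  then show "y \<in> D" "A y = - z" by auto
qed

lemma multiplier_sq_le:
  assumes "0 < c"
  shows "(a / (1 + c * lam p))\<^sup>2 \<le> a\<^sup>2"
proof -
  have "1 \<le> 1 + c * lam p"
    using assms lam_pos[of p] by simp
  then have "\<bar>a\<bar> / (1 + c * lam p) \<le> \<bar>a\<bar> / 1"
    by (intro divide_left_mono) auto
  then show ?thesis
    using \<open>1 \<le> 1 + c * lam p\<close> by (simp add: abs_le_square_iff[symmetric] abs_divide)
qed

text \<open>The vector with the coordinates on the right solves the resolvent equation. Any solution is
determined by its coordinates, which gives the injectivity that \<open>the_inv_into\<close> requires.\<close>

lemma resolvent_coordinate:
  assumes c: "0 < c"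
  shows "resolvent D A c x \<bullet> e p = (x \<bullet> e p) / (1 + c * lam p)"
proof -
  have pos: "0 < c * lam p" for p
    using c lam_pos by simp
  have "summable (\<lambda>p. ((x \<bullet> e p) / (1 + c * lam p))\<^sup>2)"
    by (rule summable_comparison_test'[OF sums_summable[OF norm_sums[of x]]])
      (simp add: multiplier_sq_le[OF c])
  then obtain y where y: "\<And>p. y \<bullet> e p = (x \<bullet> e p) / (1 + c * lam p)"
    using exists_with_coordinates[of "\<lambda>p. (x \<bullet> e p) / (1 + c * lam p)"] by blast
  have "((1 / c) *\<^sub>R (x - y)) \<bullet> e p = lam p * (y \<bullet> e p)" for p
  proof -
    have "x \<bullet> e p = (1 + c * lam p) * (y \<bullet> e p)"
      using pos[of p] by (simp add: y)
    then show ?thesis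
      using c by (simp add: inner_diff_left field_simps)
  qed
  from mem_domain_if_coordinates[OF this]
  have "y \<in> D" and "y - c *\<^sub>R A y = x"
    using c by auto
  moreover have "inj_on (\<lambda>y. y - c *\<^sub>R A y) D"
  proof (rule inj_onI)
    fix v w assume D: "v \<in> D" "w \<in> D" and eq: "v - c *\<^sub>R A v = w - c *\<^sub>R A w"
    have "v \<bullet> e p = w \<bullet> e p" for p
    proof -
      have "(v - c *\<^sub>R A v) \<bullet> e p = (w - c *\<^sub>R A w) \<bullet> e p"
        by (simp only: eq)
      then have "(1 + c * lam p) * (v \<bullet> e p) = (1 + c * lam p) * (w \<bullet> e p)"
        by (simp add: inner_diff_left A_coordinate D algebra_simps)
      then show ?thesis
        using pos[of p] by simp
    qed
    then show "v = w" by (rule eq_if_coordinates_eq)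
  qed
  ultimately have "resolvent D A c x = y"
    unfolding resolvent_def by (intro the_inv_into_f_eq)
  then show ?thesis by (simp add: y)
qed

lemma bounded_linear_resolvent:
  assumes c: "0 < c"
  shows "bounded_linear (resolvent D A c)"
proof (rule bounded_linear_intro[where K = 1])
  show "norm (resolvent D A c x) \<le> norm x * 1" for x
  proof -
    have "(resolvent D A c x \<bullet> e p)\<^sup>2 \<le> (x \<bullet> e p)\<^sup>2" for p
      by (simp add: resolvent_coordinate c multiplier_sq_le del: power_divide)
    then have "(norm (resolvent D A c x))\<^sup>2 \<le> (norm x)\<^sup>2"
      by (rule sums_le[OF _ norm_sums norm_sums])
    then show ?thesis by (simp add: power2_le_iff_abs_le)
  qed
qed (rule eq_if_coordinates_eq, simp add: resolvent_coordinate c inner_add_left add_divide_distrib)+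

lemma norm_resolvent_le:
  assumes c: "0 < c"
  shows "(1 + c * lam 0) * norm (resolvent D A c x) \<le> norm x"
proof -
  have "((1 + c * lam 0) * (resolvent D A c x \<bullet> e p))\<^sup>2 \<le> (x \<bullet> e p)\<^sup>2" for p
  proof -
    have "(1 + c * lam 0) / (1 + c * lam p) \<le> 1" "0 \<le> (1 + c * lam 0) / (1 + c * lam p)"
      using c lam_pos[of p] lam_0_pos lam_0_le[of p]
      by (auto simp: field_simps add_pos_pos intro!: divide_nonneg_nonneg add_nonneg_nonneg)
    then have "((1 + c * lam 0) / (1 + c * lam p))\<^sup>2 * (x \<bullet> e p)\<^sup>2 \<le> 1 * (x \<bullet> e p)\<^sup>2"
      by (intro mult_right_mono power_le_one) auto
    then show ?thesis
      by (simp add: resolvent_coordinate c power_mult_distrib power_divide)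
  qed
  then have "(1 + c * lam 0)\<^sup>2 * (resolvent D A c x \<bullet> e p)\<^sup>2 \<le> (x \<bullet> e p)\<^sup>2" for p
    by (simp add: power_mult_distrib)
  then have "(1 + c * lam 0)\<^sup>2 * (norm (resolvent D A c x))\<^sup>2 \<le> (norm x)\<^sup>2"
    by (rule sums_le[OF _ sums_mult[OF norm_sums] norm_sums])
  then have "((1 + c * lam 0) * norm (resolvent D A c x))\<^sup>2 \<le> (norm x)\<^sup>2"
    by (simp add: power_mult_distrib)
  then show ?thesis
    by (rule power2_le_imp_le) simp
qed

lemma norm_sq_le_sobolev_sq:
  assumes "0 \<le> s"
  shows "ennreal ((norm x)\<^sup>2) \<le> ennreal (lam 0 powr (- s)) * sobolev_sq lam e s x"
proof -
  have "(x \<bullet> e p)\<^sup>2 \<le> lam 0 powr (- s) * (lam p powr s * (x \<bullet> e p)\<^sup>2)" for p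
  proof -
    have "1 \<le> lam 0 powr (- s) * lam p powr s"
      using powr_mono2[OF assms less_imp_le[OF lam_0_pos] lam_0_le[of p]] lam_0_pos
      by (simp add: powr_minus field_simps)
    then have "1 * (x \<bullet> e p)\<^sup>2 \<le> (lam 0 powr (- s) * lam p powr s) * (x \<bullet> e p)\<^sup>2"
      by (intro mult_right_mono) auto
    then show ?thesis by (simp add: ac_simps)
  qed
  then have "(\<Sum>p. ennreal ((x \<bullet> e p)\<^sup>2))
      \<le> (\<Sum>p. ennreal (lam 0 powr (- s)) * ennreal (lam p powr s * (x \<bullet> e p)\<^sup>2))"
    by (intro suminf_le summableI) (simp add: ennreal_mult[symmetric] ennreal_leI)
  then show ?thesis
    by (simp add: sobolev_sq_def suminf_ennreal_eq[OF _ norm_sums] del: suminf_ennreal)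
qed

text \<open>In the common eigenbasis the trace condition is a condition on a series of real numbers.\<close>

lemma op_trace_frac_power:
  assumes "\<And>p. Q (e p) = q p *\<^sub>R e p"
  shows "op_trace e (\<lambda>x. frac_power lam e r (Q x)) = (\<Sum>p. ennreal (lam p powr r * q p))"
proof -
  have "frac_power lam e r (Q (e p)) = (lam p powr r * q p) *\<^sub>R e p" for p
  proof -
    have "(\<lambda>k. (lam k powr r * (Q (e p) \<bullet> e k)) *\<^sub>R e k)
        = (\<lambda>k. if k = p then (lam k powr r * q k) *\<^sub>R e k else 0)"
      by (auto simp: assms inner_basis)
    then show ?thesis
      unfolding frac_power_def using sums_single[of p "\<lambda>k. (lam k powr r * q k) *\<^sub>R e k"]
      by (simp add: sums_iff)
  qed
  then show ?thesis
    by (simp add: op_trace_def inner_basis)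
qed

end

section \<open>Mean-square limits\<close>

lemma convergent_if_summable_increments:
  fixes S :: "nat \<Rightarrow> 'a::{real_normed_vector, complete_space}"
  assumes "summable (\<lambda>k. norm (S (Suc k) - S k))"
  shows "convergent S"
proof (rule Cauchy_convergent, rule metric_CauchyI)
  fix r :: real assume r: "0 < r"
  obtain N where N: "\<And>m n. m \<ge> N \<Longrightarrow> norm (\<Sum>k=m..<n. norm (S (Suc k) - S k)) < r"
    using assms[unfolded summable_Cauchy, rule_format, OF r] by auto
  have less: "dist (S m) (S n) < r" if "m \<ge> N" "m \<le> n" for m n
  proof -
    have "norm (S n - S m) \<le> (\<Sum>k=m..<n. norm (S (Suc k) - S k))"
      using norm_sum[of "\<lambda>k. S (Suc k) - S k" "{m..<n}"] sum_Suc_diff'[OF that(2), of S] by simp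
    also have "\<dots> < r"
      using N[OF that(1), of n] by simp
    finally show ?thesis
      by (simp add: dist_norm norm_minus_commute)
  qed
  have "dist (S m) (S n) < r" if "m \<ge> N" "n \<ge> N" for m n
    using less[of m n] less[of n m] that by (cases "m \<le> n") (auto simp: dist_commute)
  then show "\<exists>M. \<forall>m\<ge>M. \<forall>n\<ge>M. dist (S m) (S n) < r" by blast
qed

text \<open>Completeness of the space of square-integrable Hilbert-valued random variables, by the Riesz--Fischer
argument: along a sufficiently fast subsequence the increments are almost surely summable, so the
subsequence converges almost surely, and Fatou's lemma identifies the limit as the mean-square
limit of the whole sequence.\<close>

lemma (in prob_space) mean_square_limit_exists:
  fixes S :: "nat \<Rightarrow> 'a \<Rightarrow> 'b::{real_inner, polish_space}"
  assumes meas [measurable]: "\<And>n. S n \<in> borel_measurable M"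
    and cauchy: "\<And>\<epsilon>. 0 < \<epsilon> \<Longrightarrow>
      \<exists>N. \<forall>m\<ge>N. \<forall>n\<ge>N. (\<integral>\<^sup>+ \<omega>. ennreal ((norm (S m \<omega> - S n \<omega>))\<^sup>2) \<partial>M) \<le> ennreal \<epsilon>"
  shows "\<exists>X \<in> borel_measurable M.
    (\<lambda>n. \<integral>\<^sup>+ \<omega>. ennreal ((norm (X \<omega> - S n \<omega>))\<^sup>2) \<partial>M) \<longlonglongrightarrow> 0"
proof -
  define dd where "dd m n = (\<integral>\<^sup>+ \<omega>. ennreal ((norm (S m \<omega> - S n \<omega>))\<^sup>2) \<partial>M)" for m n
  have "\<exists>N. \<forall>m\<ge>N. \<forall>n\<ge>N. dd m n \<le> ennreal ((1/4)^k)" for k :: nat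
    unfolding dd_def by (rule cauchy) simp
  then obtain N where N: "\<And>k m n. m \<ge> N k \<Longrightarrow> n \<ge> N k \<Longrightarrow> dd m n \<le> ennreal ((1/4)^k)"
    by metis
  \<comment> \<open>Summing the thresholds puts the index at stage \<open>k\<close> beyond every earlier threshold as well.\<close>
  define r where "r k = (\<Sum>i\<le>k. N i)" for k
  have r_ge: "N j \<le> r k" if "j \<le> k" for j k
    unfolding r_def using that by (intro member_le_sum) auto
  define d where "d k \<omega> = norm (S (r (Suc k)) \<omega> - S (r k) \<omega>)" for k \<omega>
  have d_meas [measurable]: "d k \<in> borel_measurable M" for k
    unfolding d_def by measurable
  have d_int: "(\<integral>\<^sup>+ \<omega>. ennreal (d k \<omega>) \<partial>M) \<le> ennreal (2 * (1/2)^k)" for k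
  proof -
    \<comment> \<open>Young with the weight that balances a mean square of order \<open>(1/4)^k\<close>; it replaces Cauchy--Schwarz in expectation.\<close>
    have le: "d k \<omega> \<le> (1/2)^k + 2^k * (norm (S (r (Suc k)) \<omega> - S (r k) \<omega>))\<^sup>2" for \<omega>
    proof -
      have "2 * (2^k * d k \<omega>) \<le> 1 + (2^k * d k \<omega>)\<^sup>2"
        using zero_le_power2[of "2^k * d k \<omega> - 1"] by (simp add: power2_diff)
      moreover have "0 \<le> 2^k * d k \<omega>"
        by (simp add: d_def)
      ultimately have "2^k * d k \<omega> \<le> 1 + (2^k * d k \<omega>)\<^sup>2" by linarith
      then have "(1/2)^k * (2^k * d k \<omega>) \<le> (1/2)^k * (1 + (2^k * d k \<omega>)\<^sup>2)"
        by (intro mult_left_mono) auto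
      then show ?thesis
        by (simp add: d_def power_mult_distrib power_divide power2_eq_square field_simps)
    qed
    have "(\<integral>\<^sup>+ \<omega>. ennreal (d k \<omega>) \<partial>M)
        \<le> (\<integral>\<^sup>+ \<omega>. ennreal ((1/2)^k) + ennreal (2^k) * ennreal ((norm (S (r (Suc k)) \<omega> - S (r k) \<omega>))\<^sup>2) \<partial>M)"
      using le by (intro nn_integral_mono)
        (simp add: ennreal_mult[symmetric] ennreal_plus[symmetric] ennreal_leI del: ennreal_plus)
    also have "\<dots> = ennreal ((1/2)^k) + ennreal (2^k) * dd (r (Suc k)) (r k)"
      unfolding dd_def by (subst nn_integral_add) (auto simp: nn_integral_cmult emeasure_space_1)
    also have "\<dots> \<le> ennreal ((1/2)^k) + ennreal (2^k) * ennreal ((1/4)^k)"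
      by (intro add_left_mono mult_left_mono N r_ge) auto
    also have "\<dots> = ennreal ((1/2)^k + 2^k * (1/4)^k)"
      by (simp add: ennreal_mult[symmetric] ennreal_plus[symmetric] del: ennreal_plus)
    also have "(1/2)^k + 2^k * (1/4)^k = (2 * (1/2)^k :: real)"
      by (simp add: power_mult_distrib[symmetric])
    finally show ?thesis .
  qed
  have "(\<integral>\<^sup>+ \<omega>. (\<Sum>k. ennreal (d k \<omega>)) \<partial>M) \<le> (\<Sum>k. ennreal (2 * (1/2)^k))"
    by (subst nn_integral_suminf) (auto intro!: suminf_le summableI d_int)
  also have "\<dots> < \<top>"
    unfolding less_top[symmetric]
    by (intro ennreal_suminf_neq_top summable_mult summable_geometric) auto
  finally have fin: "AE \<omega> in M. (\<Sum>k. ennreal (d k \<omega>)) \<noteq> \<infinity>"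
    by (intro nn_integral_PInf_AE) auto
  define E where "E = {\<omega> \<in> space M. (\<Sum>k. ennreal (d k \<omega>)) \<noteq> \<infinity>}"
  have [measurable]: "E \<in> sets M"
    unfolding E_def by measurable
  \<comment> \<open>Cutting off on the exceptional null set makes the limit exist everywhere and so be measurable.\<close>
  define Y where "Y k \<omega> = indicator E \<omega> *\<^sub>R S (r k) \<omega>" for k \<omega>
  have conv: "convergent (\<lambda>k. Y k \<omega>)" for \<omega>
  proof (cases "\<omega> \<in> E")
    case True
    then have "summable (\<lambda>k. d k \<omega>)"
      unfolding E_def by (intro summable_suminf_not_top) (auto simp: d_def)
    then show ?thesis
      using True unfolding Y_def d_def by (simp add: convergent_if_summable_increments)
  next
    case False
    then show ?thesis by (simp add: Y_def convergent_const)
  qed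
  define X where "X \<omega> = lim (\<lambda>k. Y k \<omega>)" for \<omega>
  have Y_X: "(\<lambda>k. Y k \<omega>) \<longlonglongrightarrow> X \<omega>" for \<omega>
    using conv unfolding X_def convergent_LIMSEQ_iff by blast
  have [measurable]: "X \<in> borel_measurable M"
    by (rule borel_measurable_LIMSEQ_metric[OF _ Y_X]) (simp add: Y_def)
  have fatou: "(\<integral>\<^sup>+ \<omega>. ennreal ((norm (X \<omega> - S n \<omega>))\<^sup>2) \<partial>M) \<le> ennreal ((1/4)^j)" if "n \<ge> N j" for n j
  proof -
    have "(\<integral>\<^sup>+ \<omega>. ennreal ((norm (X \<omega> - S n \<omega>))\<^sup>2) \<partial>M)
        = (\<integral>\<^sup>+ \<omega>. liminf (\<lambda>k. ennreal ((norm (S (r k) \<omega> - S n \<omega>))\<^sup>2)) \<partial>M)"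
    proof (rule nn_integral_cong_AE, use fin AE_space in eventually_elim)
      fix \<omega> assume "(\<Sum>k. ennreal (d k \<omega>)) \<noteq> \<infinity>" "\<omega> \<in> space M"
      then have "(\<lambda>k. S (r k) \<omega>) \<longlonglongrightarrow> X \<omega>"
        using Y_X[of \<omega>] by (simp add: Y_def E_def)
      then have "(\<lambda>k. ennreal ((norm (S (r k) \<omega> - S n \<omega>))\<^sup>2)) \<longlonglongrightarrow> ennreal ((norm (X \<omega> - S n \<omega>))\<^sup>2)"
        by (intro tendsto_ennrealI tendsto_intros)
      then show "ennreal ((norm (X \<omega> - S n \<omega>))\<^sup>2)
          = liminf (\<lambda>k. ennreal ((norm (S (r k) \<omega> - S n \<omega>))\<^sup>2))"
        by (rule lim_imp_Liminf[OF trivial_limit_sequentially, symmetric])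
    qed
    also have "\<dots> \<le> liminf (\<lambda>k. dd (r k) n)"
      unfolding dd_def by (rule nn_integral_liminf) measurable
    also have "\<dots> \<le> ennreal ((1/4)^j)"
    proof (rule Liminf_le)
      show "\<forall>\<^sub>F k in sequentially. dd (r k) n \<le> ennreal ((1/4)^j)"
        using eventually_ge_at_top[of j] by eventually_elim (intro N that r_ge)
    qed simp
    finally show ?thesis .
  qed
  have "(\<lambda>n. \<integral>\<^sup>+ \<omega>. ennreal ((norm (X \<omega> - S n \<omega>))\<^sup>2) \<partial>M) \<longlonglongrightarrow> 0"
  proof (rule order_tendstoI)
    fix a :: ennreal assume "0 < a"
    moreover have "(\<lambda>j. ennreal ((1/4)^j)) \<longlonglongrightarrow> ennreal 0"
      by (intro tendsto_ennrealI LIMSEQ_power_zero) simp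
    ultimately have "\<forall>\<^sub>F j in sequentially. ennreal ((1/4)^j) < a"
      by (intro order_tendstoD(2)) auto
    then obtain j where j: "ennreal ((1/4)^j) < a"
      by (auto simp: eventually_sequentially)
    show "\<forall>\<^sub>F n in sequentially. (\<integral>\<^sup>+ \<omega>. ennreal ((norm (X \<omega> - S n \<omega>))\<^sup>2) \<partial>M) < a"
      by (rule eventually_mono[OF eventually_ge_at_top[of "N j"]]) (rule le_less_trans[OF fatou j])
  qed auto
  then show ?thesis
    using \<open>X \<in> borel_measurable M\<close> by blast
qed

section \<open>Orthonormal random variables and Wiener increments\<close>

text \<open>Second moments of linear functionals of the noise depend only on this orthonormality.\<close>

definition (in prob_space) orthonormal_variables :: "(nat \<Rightarrow> 'a \<Rightarrow> real) \<Rightarrow> bool" where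
  "orthonormal_variables \<xi> \<longleftrightarrow> (\<forall>i. \<xi> i \<in> borel_measurable M) \<and>
     (\<forall>i j. integrable M (\<lambda>\<omega>. \<xi> i \<omega> * \<xi> j \<omega>) \<and>
            expectation (\<lambda>\<omega>. \<xi> i \<omega> * \<xi> j \<omega>) = (if i = j then 1 else 0))"

lemma (in prob_space) orthonormal_variables_measurable:
  "orthonormal_variables \<xi> \<Longrightarrow> \<xi> i \<in> borel_measurable M"
  by (simp add: orthonormal_variables_def)

lemma (in prob_space) orthonormal_variables_pythagoras:
  fixes x :: "nat \<Rightarrow> 'b::real_inner"
  assumes \<xi>: "orthonormal_variables \<xi>" and I: "finite I"
  shows "(\<integral>\<^sup>+ \<omega>. ennreal ((norm (\<Sum>i\<in>I. \<xi> i \<omega> *\<^sub>R x i))\<^sup>2) \<partial>M) = ennreal (\<Sum>i\<in>I. (norm (x i))\<^sup>2)"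
proof -
  have eq: "(norm (\<Sum>i\<in>I. \<xi> i \<omega> *\<^sub>R x i))\<^sup>2 = (\<Sum>i\<in>I. \<Sum>j\<in>I. (x i \<bullet> x j) * (\<xi> i \<omega> * \<xi> j \<omega>))" for \<omega>
    by (simp add: power2_norm_eq_inner inner_sum_left inner_sum_right sum_distrib_left ac_simps inner_commute)
  have prod: "integrable M (\<lambda>\<omega>. \<xi> i \<omega> * \<xi> j \<omega>)" for i j
    using \<xi> by (simp add: orthonormal_variables_def)
  then have int: "integrable M (\<lambda>\<omega>. (x i \<bullet> x j) * (\<xi> i \<omega> * \<xi> j \<omega>))" for i j
    by simp
  have "(\<integral>\<^sup>+ \<omega>. ennreal ((norm (\<Sum>i\<in>I. \<xi> i \<omega> *\<^sub>R x i))\<^sup>2) \<partial>M)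
      = ennreal (expectation (\<lambda>\<omega>. (norm (\<Sum>i\<in>I. \<xi> i \<omega> *\<^sub>R x i))\<^sup>2))"
  proof (rule nn_integral_eq_integral)
    show "integrable M (\<lambda>\<omega>. (norm (\<Sum>i\<in>I. \<xi> i \<omega> *\<^sub>R x i))\<^sup>2)"
      unfolding eq by (intro Bochner_Integration.integrable_sum int)
  qed simp
  also have "expectation (\<lambda>\<omega>. (norm (\<Sum>i\<in>I. \<xi> i \<omega> *\<^sub>R x i))\<^sup>2)
      = (\<Sum>i\<in>I. \<Sum>j\<in>I. (x i \<bullet> x j) * expectation (\<lambda>\<omega>. \<xi> i \<omega> * \<xi> j \<omega>))"
    by (simp add: eq prod Bochner_Integration.integral_sum Bochner_Integration.integrable_sum)
  also have "\<dots> = (\<Sum>i\<in>I. \<Sum>j\<in>I. if i = j then x i \<bullet> x j else 0)"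
    using \<xi> by (intro sum.cong) (auto simp: orthonormal_variables_def)
  also have "\<dots> = (\<Sum>i\<in>I. (norm (x i))\<^sup>2)"
    using I by (simp add: power2_norm_eq_inner)
  finally show ?thesis .
qed

lemma (in prob_space) orthonormal_variables_if_indep:
  assumes indep: "indep_vars (\<lambda>_. borel) \<xi> UNIV"
    and mean: "\<And>i. integrable M (\<xi> i)" "\<And>i. expectation (\<xi> i) = 0"
    and sq: "\<And>i. integrable M (\<lambda>\<omega>. (\<xi> i \<omega>)\<^sup>2)" "\<And>i. expectation (\<lambda>\<omega>. (\<xi> i \<omega>)\<^sup>2) = 1"
  shows "orthonormal_variables \<xi>"
proof -
  have *: "integrable M (\<lambda>\<omega>. \<xi> i \<omega> * \<xi> j \<omega>) \<and> expectation (\<lambda>\<omega>. \<xi> i \<omega> * \<xi> j \<omega>) = 0"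
    if "i \<noteq> j" for i j
  proof -
    have "indep_vars (\<lambda>_. borel) \<xi> {i, j}"
      using indep by (rule indep_vars_subset) simp
    from indep_vars_integrable[OF _ this] indep_vars_lebesgue_integral[OF _ this]
    show ?thesis
      using that mean by simp
  qed
  have "integrable M (\<lambda>\<omega>. \<xi> i \<omega> * \<xi> j \<omega>) \<and>
      expectation (\<lambda>\<omega>. \<xi> i \<omega> * \<xi> j \<omega>) = (if i = j then 1 else 0)" for i j
    using *[of i j] sq[of i] by (cases "i = j") (auto simp: power2_eq_square)
  then show ?thesis
    using mean(1) by (auto simp: orthonormal_variables_def)
qed

definition normalized_increment ::
    "(nat \<Rightarrow> real \<Rightarrow> 'w \<Rightarrow> real) \<Rightarrow> real \<Rightarrow> nat \<Rightarrow> nat \<Rightarrow> 'w \<Rightarrow> real" where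
  "normalized_increment \<beta> h n p \<omega> = (\<beta> p ((real n + 1) * h) \<omega> - \<beta> p (real n * h) \<omega>) / sqrt h"

context prob_space
begin

lemma increment_moments:
  assumes \<beta>: "wiener_process M (\<beta> p)" and h: "0 < h"
  shows "integrable M (normalized_increment \<beta> h n p)"
    and "expectation (normalized_increment \<beta> h n p) = 0"
    and "integrable M (\<lambda>\<omega>. (normalized_increment \<beta> h n p \<omega>)\<^sup>2)"
    and "expectation (\<lambda>\<omega>. (normalized_increment \<beta> h n p \<omega>)\<^sup>2) = 1"
proof -
  let ?X = "\<lambda>\<omega>. \<beta> p ((real n + 1) * h) \<omega> - \<beta> p (real n * h) \<omega>"
  let ?f = "normal_density 0 (sqrt h)"
  have dist: "distributed M lborel ?X (\<lambda>x. ennreal (?f x))"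
  proof -
    have "0 \<le> real n * h" "real n * h < (real n + 1) * h" "(real n + 1) * h - real n * h = h"
      using h by (auto simp: algebra_simps)
    then show ?thesis
      using \<beta> unfolding wiener_process_def by metis
  qed
  have s: "0 < sqrt h" using h by simp
  have "integrable lborel (\<lambda>x. ?f x * x)"
    using integrable_normal_moment_nz_1[OF s, of 0] .
  then have int: "integrable M ?X"
    using distributed_integrable[OF dist, of "\<lambda>x. x"] by simp
  then show "integrable M (normalized_increment \<beta> h n p)"
    by (simp add: normalized_increment_def[abs_def])
  have mean: "expectation ?X = 0"
    by (rule normal_distributed_expectation[OF s dist])
  then show "expectation (normalized_increment \<beta> h n p) = 0"
    by (simp add: normalized_increment_def[abs_def])
  have "integrable lborel (\<lambda>x. ?f x * x\<^sup>2)"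
    using integrable_normal_moment[OF s, of 0 2] by simp
  then have int2: "integrable M (\<lambda>\<omega>. (?X \<omega>)\<^sup>2)"
    using distributed_integrable[OF dist, of "\<lambda>x. x\<^sup>2"] by simp
  then show "integrable M (\<lambda>\<omega>. (normalized_increment \<beta> h n p \<omega>)\<^sup>2)"
    by (simp add: normalized_increment_def power_divide)
  have "expectation (\<lambda>\<omega>. (?X \<omega>)\<^sup>2) = h"
    using normal_distributed_variance[OF s dist] mean h by simp
  then show "expectation (\<lambda>\<omega>. (normalized_increment \<beta> h n p \<omega>)\<^sup>2) = 1"
    using h by (simp add: normalized_increment_def power_divide)
qed

text \<open>Independence of the increments of one Wiener process over successive time steps.\<close>

lemma orthonormal_in_time:
  assumes \<beta>: "wiener_process M (\<beta> p)" and h: "0 < h"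
  shows "orthonormal_variables (\<lambda>n. normalized_increment \<beta> h n p)"
proof (rule orthonormal_variables_if_indep)
  have "indep_vars (\<lambda>_. borel)
      (\<lambda>i \<omega>. \<beta> p (real (Suc i) * h) \<omega> - \<beta> p (real i * h) \<omega>) UNIV"
  proof -
    have "0 \<le> real 0 * h" "incseq (\<lambda>i. real i * h)"
      using h by (auto simp: incseq_def)
    then show ?thesis
      using \<beta>[unfolded wiener_process_def, THEN conjunct2, THEN conjunct2, THEN conjunct2, THEN conjunct2,
          rule_format, of "\<lambda>i. real i * h"] by simp
  qed
  from indep_vars_compose2[OF this, of "\<lambda>_ x. x / sqrt h" "\<lambda>_. borel"]
  show "indep_vars (\<lambda>_. borel) (\<lambda>n. normalized_increment \<beta> h n p) UNIV"
    by (simp add: normalized_increment_def[abs_def] add.commute)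
qed (use increment_moments[of \<beta> p h, OF \<beta> h] in auto)

text \<open>Independence of the different Wiener processes within one time step: an increment is a measurable
function of the path.\<close>

lemma orthonormal_in_space:
  assumes \<beta>: "independent_wiener_processes M \<beta>" and h: "0 < h"
  shows "orthonormal_variables (normalized_increment \<beta> h n)"
proof (rule orthonormal_variables_if_indep)
  have indep: "indep_vars (\<lambda>_. PiM {0..} (\<lambda>_. borel)) (\<lambda>p \<omega>. \<lambda>t\<in>{0..}. \<beta> p t \<omega>) UNIV"
    using \<beta> by (simp add: independent_wiener_processes_def)
  have nonneg: "0 \<le> (real n + 1) * h" "0 \<le> real n * h"
    using h by auto
  have "(\<lambda>\<phi>. (\<phi> ((real n + 1) * h) - \<phi> (real n * h)) / sqrt h)
      \<in> measurable (PiM {0..} (\<lambda>_. borel :: real measure)) (borel :: real measure)"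
    using nonneg by (intro borel_measurable_divide borel_measurable_diff measurable_component_singleton) auto
  from indep_vars_compose2[OF indep this]
  show "indep_vars (\<lambda>_. borel) (normalized_increment \<beta> h n) UNIV"
    using nonneg by (simp add: normalized_increment_def[abs_def])
qed (use \<beta> increment_moments[of \<beta> _ h, OF _ h] in \<open>auto simp: independent_wiener_processes_def\<close>)

end

section \<open>Images of the cylindrical noise\<close>

lemma xi_partial_eq:
  "xi_partial q e \<beta> h n N \<omega> = (\<Sum>p<N. normalized_increment \<beta> h n p \<omega> *\<^sub>R (sqrt (q p) *\<^sub>R e p))"
  unfolding xi_partial_def WQ_partial_def normalized_increment_def sum_subtractf[symmetric]
    scaleR_sum_right scaleR_diff_left[symmetric]
  by (intro sum.cong) (auto simp: algebra_simps diff_divide_distrib)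

text \<open>The Hilbert--Schmidt condition is what makes the image of the cylindrical noise under \<open>J\<close> a genuine
random variable.\<close>

locale wiener_noise = prob_space M
  for M :: "'w measure" +
  fixes \<beta> :: "nat \<Rightarrow> real \<Rightarrow> 'w \<Rightarrow> real" and q :: "nat \<Rightarrow> real"
    and e :: "nat \<Rightarrow> 'a::{real_inner, polish_space}"
    and h :: real and J :: "'a \<Rightarrow> 'a"
  assumes \<beta>: "independent_wiener_processes M \<beta>"
    and q_nonneg: "\<And>p. 0 \<le> q p"
    and h_pos: "0 < h"
    and J: "bounded_linear J"
    and hilbert_schmidt: "summable (\<lambda>p. q p * (norm (J (e p)))\<^sup>2)"
begin

abbreviation \<xi> where "\<xi> \<equiv> normalized_increment \<beta> h"

lemmas xi_measurable [measurable] = orthonormal_variables_measurable[OF orthonormal_in_space[OF \<beta> h_pos]]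

lemma J_xi_partial: "J (xi_partial q e \<beta> h n N \<omega>) = (\<Sum>p<N. \<xi> n p \<omega> *\<^sub>R (sqrt (q p) *\<^sub>R J (e p)))"
proof -
  interpret J: bounded_linear J by (rule J)
  show ?thesis
    by (simp add: xi_partial_eq J.sum J.scaleR)
qed

text \<open>By Pythagoras the mean-square distance of two partial sums is a section of the Hilbert--Schmidt series,
so the limit chosen by \<open>apply_xi\<close> exists and has the properties by which it is chosen.\<close>

lemma apply_xi_properties:
  shows apply_xi_measurable [measurable]: "apply_xi M q e \<beta> J h n \<in> borel_measurable M"
    and apply_xi_limit: "(\<lambda>N. \<integral>\<^sup>+ \<omega>. ennreal ((norm (apply_xi M q e \<beta> J h n \<omega>
      - J (xi_partial q e \<beta> h n N \<omega>)))\<^sup>2) \<partial>M) \<longlonglongrightarrow> 0"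
proof -
  let ?S = "\<lambda>N \<omega>. J (xi_partial q e \<beta> h n N \<omega>)"
  let ?c = "\<lambda>p. (norm (sqrt (q p) *\<^sub>R J (e p)))\<^sup>2"
  have c: "?c p = q p * (norm (J (e p)))\<^sup>2" for p
    using q_nonneg[of p] by (simp add: power_mult_distrib)
  have diff: "(\<integral>\<^sup>+ \<omega>. ennreal ((norm (?S k \<omega> - ?S m \<omega>))\<^sup>2) \<partial>M) = ennreal (\<Sum>p=m..<k. ?c p)" if "m \<le> k" for m k
  proof -
    have eq: "?S k \<omega> - ?S m \<omega> = (\<Sum>p=m..<k. \<xi> n p \<omega> *\<^sub>R (sqrt (q p) *\<^sub>R J (e p)))" for \<omega>
      unfolding J_xi_partial using sum_diff_nat_ivl[of 0 m k] that by (simp add: lessThan_atLeast0)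
    show ?thesis
      unfolding eq by (rule orthonormal_variables_pythagoras[OF orthonormal_in_space[OF \<beta> h_pos]]) simp
  qed
  have "\<exists>X \<in> borel_measurable M. (\<lambda>N. \<integral>\<^sup>+ \<omega>. ennreal ((norm (X \<omega> - ?S N \<omega>))\<^sup>2) \<partial>M) \<longlonglongrightarrow> 0"
  proof (rule mean_square_limit_exists)
    show "?S N \<in> borel_measurable M" for N
      unfolding J_xi_partial by measurable
    fix \<epsilon> :: real assume \<epsilon>: "0 < \<epsilon>"
    obtain N where N: "\<And>m k. m \<ge> N \<Longrightarrow> norm (\<Sum>p=m..<k. ?c p) < \<epsilon>"
      using hilbert_schmidt[unfolded summable_Cauchy, rule_format, OF \<epsilon>] unfolding c by auto
    have le: "(\<integral>\<^sup>+ \<omega>. ennreal ((norm (?S k \<omega> - ?S m \<omega>))\<^sup>2) \<partial>M) \<le> ennreal \<epsilon>"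
      if "m \<ge> N" "m \<le> k" for m k
      unfolding diff[OF that(2)] using N[OF that(1), of k] by (intro ennreal_leI) simp
    have "(\<integral>\<^sup>+ \<omega>. ennreal ((norm (?S m \<omega> - ?S k \<omega>))\<^sup>2) \<partial>M) \<le> ennreal \<epsilon>"
      if "m \<ge> N" "k \<ge> N" for m k
      using le[of m k] le[of k m] that by (cases "m \<le> k") (auto simp: norm_minus_commute)
    then show "\<exists>N. \<forall>m\<ge>N. \<forall>k\<ge>N. (\<integral>\<^sup>+ \<omega>. ennreal ((norm (?S m \<omega> - ?S k \<omega>))\<^sup>2) \<partial>M) \<le> ennreal \<epsilon>"
      by blast
  qed
  then have "\<exists>X. X \<in> borel_measurable M \<and>
      (\<lambda>N. \<integral>\<^sup>+ \<omega>. ennreal ((norm (X \<omega> - ?S N \<omega>))\<^sup>2) \<partial>M) \<longlonglongrightarrow> 0"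
    by blast
  from someI_ex[OF this] show "apply_xi M q e \<beta> J h n \<in> borel_measurable M"
    "(\<lambda>N. \<integral>\<^sup>+ \<omega>. ennreal ((norm (apply_xi M q e \<beta> J h n \<omega> - ?S N \<omega>))\<^sup>2) \<partial>M) \<longlonglongrightarrow> 0"
    unfolding apply_xi_def by auto
qed

text \<open>The factor 2 comes from splitting off the error of the partial sums before letting it tend to
zero. The estimate serves operators \<open>J\<close> that are not diagonal in the basis.\<close>

lemma apply_xi_second_moment_le:
  assumes "norm y \<le> 1" and "\<And>N. (\<Sum>p<N. q p * (J (e p) \<bullet> y)\<^sup>2) \<le> c"
  shows "(\<integral>\<^sup>+ \<omega>. ennreal ((apply_xi M q e \<beta> J h n \<omega> \<bullet> y)\<^sup>2) \<partial>M) \<le> ennreal (2 * c)"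
proof -
  let ?X = "apply_xi M q e \<beta> J h n"
  let ?S = "\<lambda>N \<omega>. J (xi_partial q e \<beta> h n N \<omega>)"
  let ?r = "\<lambda>N. \<integral>\<^sup>+ \<omega>. ennreal ((norm (?X \<omega> - ?S N \<omega>))\<^sup>2) \<partial>M"
  have "(\<integral>\<^sup>+ \<omega>. ennreal ((?X \<omega> \<bullet> y)\<^sup>2) \<partial>M) \<le> 2 * ?r N + ennreal (2 * c)" for N
  proof -
    have [measurable]: "?S N \<in> borel_measurable M"
      unfolding J_xi_partial by measurable
    have c: "0 \<le> c" using assms(2)[of 0] by simp
    have eq: "?S N \<omega> \<bullet> y = (\<Sum>p<N. \<xi> n p \<omega> *\<^sub>R (sqrt (q p) * (J (e p) \<bullet> y)))" for \<omega>
      by (simp add: J_xi_partial inner_sum_left mult.assoc)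
    have "(\<integral>\<^sup>+ \<omega>. ennreal ((?S N \<omega> \<bullet> y)\<^sup>2) \<partial>M) = ennreal (\<Sum>p<N. (sqrt (q p) * (J (e p) \<bullet> y))\<^sup>2)"
      using orthonormal_variables_pythagoras[OF orthonormal_in_space[OF \<beta> h_pos], of "{..<N}"
          n "\<lambda>p. sqrt (q p) * (J (e p) \<bullet> y)"] by (simp add: eq)
    also have "\<dots> \<le> ennreal c"
      using assms(2)[of N] q_nonneg by (intro ennreal_leI) (simp add: power_mult_distrib)
    finally have S: "(\<integral>\<^sup>+ \<omega>. ennreal ((?S N \<omega> \<bullet> y)\<^sup>2) \<partial>M) \<le> ennreal c" .
    have "(?X \<omega> \<bullet> y)\<^sup>2 \<le> 2 * (norm (?X \<omega> - ?S N \<omega>))\<^sup>2 + 2 * (?S N \<omega> \<bullet> y)\<^sup>2" for \<omega>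
    proof -
      have "\<bar>(?X \<omega> - ?S N \<omega>) \<bullet> y\<bar> \<le> norm (?X \<omega> - ?S N \<omega>) * norm y"
        by (rule Cauchy_Schwarz_ineq2)
      also have "\<dots> \<le> norm (?X \<omega> - ?S N \<omega>) * 1"
        by (intro mult_left_mono assms) auto
      finally have "\<bar>(?X \<omega> - ?S N \<omega>) \<bullet> y\<bar>\<^sup>2 \<le> (norm (?X \<omega> - ?S N \<omega>))\<^sup>2"
        by (intro power_mono) auto
      moreover have "(?X \<omega> \<bullet> y)\<^sup>2 \<le> 2 * ((?X \<omega> - ?S N \<omega>) \<bullet> y)\<^sup>2 + 2 * (?S N \<omega> \<bullet> y)\<^sup>2"
        using square_sum_le[of "(?X \<omega> - ?S N \<omega>) \<bullet> y" "?S N \<omega> \<bullet> y"]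
        by (simp add: inner_diff_left)
      ultimately show ?thesis by simp
    qed
    then have "(\<integral>\<^sup>+ \<omega>. ennreal ((?X \<omega> \<bullet> y)\<^sup>2) \<partial>M)
        \<le> (\<integral>\<^sup>+ \<omega>. ennreal 2 * ennreal ((norm (?X \<omega> - ?S N \<omega>))\<^sup>2) + ennreal 2 * ennreal ((?S N \<omega> \<bullet> y)\<^sup>2) \<partial>M)"
      by (intro nn_integral_mono)
        (simp add: ennreal_mult[symmetric] ennreal_plus[symmetric] ennreal_leI del: ennreal_plus ennreal_numeral)
    also have "\<dots> = ennreal 2 * ?r N + ennreal 2 * (\<integral>\<^sup>+ \<omega>. ennreal ((?S N \<omega> \<bullet> y)\<^sup>2) \<partial>M)"
      by (subst nn_integral_add) (auto simp: nn_integral_cmult)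
    also have "\<dots> \<le> ennreal 2 * ?r N + ennreal 2 * ennreal c"
      by (intro add_left_mono mult_left_mono S) auto
    also have "\<dots> = 2 * ?r N + ennreal (2 * c)"
      using c by (simp add: ennreal_mult)
    finally show ?thesis .
  qed
  moreover have "(\<lambda>N. 2 * ?r N + ennreal (2 * c)) \<longlonglongrightarrow> 2 * 0 + ennreal (2 * c)"
    by (intro tendsto_add tendsto_const tendsto_mult_ennreal apply_xi_limit) auto
  ultimately show ?thesis
    by (intro LIMSEQ_le_const[where X = "\<lambda>N. 2 * ?r N + ennreal (2 * c)"]) auto
qed

text \<open>For a diagonal \<open>J\<close> the coordinates of the partial sums are eventually constant, so the
mean-square limit has them exactly, up to a null set.\<close>

lemma apply_xi_coordinate_AE:
  assumes "\<And>p. J (e p) \<bullet> e k = (if p = k then c else 0)" and "norm (e k) \<le> 1"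
  shows "AE \<omega> in M. apply_xi M q e \<beta> J h n \<omega> \<bullet> e k = c * sqrt (q k) * \<xi> n k \<omega>"
proof -
  let ?X = "apply_xi M q e \<beta> J h n"
  let ?S = "\<lambda>N \<omega>. J (xi_partial q e \<beta> h n N \<omega>)"
  let ?Y = "\<lambda>\<omega>. c * sqrt (q k) * \<xi> n k \<omega>"
  let ?d = "\<integral>\<^sup>+ \<omega>. ennreal ((?X \<omega> \<bullet> e k - ?Y \<omega>)\<^sup>2) \<partial>M"
  have "?d \<le> (\<integral>\<^sup>+ \<omega>. ennreal ((norm (?X \<omega> - ?S N \<omega>))\<^sup>2) \<partial>M)" if "N > k" for N
  proof (intro nn_integral_mono ennreal_leI)
    fix \<omega>
    have "?S N \<omega> \<bullet> e k = (\<Sum>p<N. if p = k then ?Y \<omega> else 0)"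
      unfolding J_xi_partial inner_sum_left by (intro sum.cong) (auto simp: assms(1))
    also have "\<dots> = ?Y \<omega>"
      using that by simp
    finally have "?X \<omega> \<bullet> e k - ?Y \<omega> = (?X \<omega> - ?S N \<omega>) \<bullet> e k"
      by (simp add: inner_diff_left)
    also have "\<bar>\<dots>\<bar> \<le> norm (?X \<omega> - ?S N \<omega>) * norm (e k)"
      by (rule Cauchy_Schwarz_ineq2)
    also have "\<dots> \<le> norm (?X \<omega> - ?S N \<omega>) * 1"
      by (intro mult_left_mono assms) auto
    finally have "\<bar>?X \<omega> \<bullet> e k - ?Y \<omega>\<bar>\<^sup>2 \<le> (norm (?X \<omega> - ?S N \<omega>))\<^sup>2"
      by (intro power_mono) auto
    then show "(?X \<omega> \<bullet> e k - ?Y \<omega>)\<^sup>2 \<le> (norm (?X \<omega> - ?S N \<omega>))\<^sup>2" by simp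
  qed
  then have "?d \<le> 0"
    by (intro LIMSEQ_le_const[OF apply_xi_limit[of n]]) (meson Suc_le_eq)
  then have "AE \<omega> in M. ennreal ((?X \<omega> \<bullet> e k - ?Y \<omega>)\<^sup>2) = 0"
    by (subst nn_integral_0_iff_AE[symmetric]) auto
  then show ?thesis by eventually_elim simp
qed

end

section \<open>A discrete Gronwall estimate\<close>

text \<open>The discrete Gronwall estimate behind the bounds uniform in time: if the damping \<open>1 + h l\<close> beats the
growth \<open>1 + h L\<close>, then the fixed point \<open>c / (l - L)\<close> of the recursion does not depend on \<open>h\<close>.\<close>

lemma affine_recursion_bounded:
  fixes a :: "nat \<Rightarrow> ennreal"
  assumes h: "0 < h" and L: "0 \<le> L" "L < l" and c: "0 \<le> c"
    and step: "\<And>n. ennreal (1 + h * l) * a (Suc n) \<le> ennreal (1 + h * L) * a n + ennreal (h * c)"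
  shows "a n \<le> a 0 + ennreal (c / (l - L))"
proof (cases "a 0")
  case (real r)
  define K where "K = r + c / (l - L)"
  have K: "0 \<le> K" "ennreal K = a 0 + ennreal (c / (l - L))"
    using real L c by (auto simp: K_def ennreal_plus[symmetric] simp del: ennreal_plus)
  have "a n \<le> ennreal K"
  proof (induction n)
    case 0
    then show ?case using K by simp
  next
    case (Suc n)
    have "(l - L) * K = (l - L) * r + c"
      using L by (simp add: K_def distrib_left)
    moreover have "0 \<le> (l - L) * r"
      using L real by simp
    ultimately have "c \<le> (l - L) * K" by simp
    then have "h * c \<le> h * ((l - L) * K)"
      using h by (intro mult_left_mono) auto
    then have le: "(1 + h * L) * K + h * c \<le> (1 + h * l) * K"
      by (simp add: algebra_simps)
    have "ennreal (1 + h * l) * a (Suc n) \<le> ennreal (1 + h * L) * ennreal K + ennreal (h * c)"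
      using step[of n] Suc.IH by (meson add_right_mono mult_left_mono order_trans zero_le)
    also have "\<dots> = ennreal ((1 + h * L) * K + h * c)"
      using h L c K(1) by (simp add: ennreal_mult ennreal_plus)
    also have "\<dots> \<le> ennreal ((1 + h * l) * K)"
      by (intro ennreal_leI le)
    also have "\<dots> = ennreal (1 + h * l) * ennreal K"
      using h L K(1) by (simp add: ennreal_mult)
    finally have *: "ennreal (1 + h * l) * a (Suc n) \<le> ennreal (1 + h * l) * ennreal K" .
    have "0 < 1 + h * l"
      using h L by (intro add_pos_nonneg) auto
    then show ?case
      using * by (subst (asm) ennreal_mult_le_mult_iff) auto
  qed
  then show ?thesis by (simp add: K(2))
qed simp

section \<open>Constants of the moment bounds\<close>

text \<open>Everything that determines the final constant. The time step and the noise are deliberately absent: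
\<open>T\<close> is the only trace of the noise in the bounds, which makes them uniform in the time step.\<close>

locale dissipative_drift = negative_diagonal_operator e D A lam
  for e :: "nat \<Rightarrow> 'a::{real_inner, polish_space}" and D A lam +
  fixes F :: "'a \<Rightarrow> 'a" and L s T :: real
  assumes F_lipschitz: "\<And>x y. norm (F x - F y) \<le> L * norm (x - y)"
    and L_nonneg: "0 \<le> L" and L_less: "L < lam 0"
    and s_nonneg: "0 \<le> s" and s_le_1: "s \<le> 1"
    and T_nonneg: "0 \<le> T"
begin

text \<open>Three nested bounds: on the second moment of the part of the drift that does not depend on the
remainder, on the second moment of the whole drift, and on the second moment of the scheme relative
to \<open>1 + |u\<^sub>0|\<^sub>s\<^sup>2\<close>.\<close>

definition drift_moment :: real where
  "drift_moment = 2 * (norm (F 0))\<^sup>2 + 4 * L\<^sup>2 * (lam 0 powr (- s) * T)"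

definition force_moment :: "'a \<Rightarrow> real" where
  "force_moment u0 = 2 * L\<^sup>2 * ((norm u0)\<^sup>2 + drift_moment / (lam 0 - L)\<^sup>2) + 2 * drift_moment"

definition growth_constant :: real where
  "growth_constant = 2 + 2 * (lam 0 powr (s - 1) / lam 0
     * (2 * L\<^sup>2 * (lam 0 powr (- s) + drift_moment / (lam 0 - L)\<^sup>2) + 2 * drift_moment)) + T"

lemma drift_moment_nonneg: "0 \<le> drift_moment"
  using T_nonneg by (simp add: drift_moment_def)

lemma force_moment_nonneg: "0 \<le> force_moment u0"
  using drift_moment_nonneg by (simp add: force_moment_def)

lemma growth_constant_nonneg: "0 \<le> growth_constant"
  using drift_moment_nonneg T_nonneg lam_0_pos by (simp add: growth_constant_def)

lemma force_moment_growth: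
  assumes r: "0 \<le> r" and u0: "sobolev_sq lam e s u0 = ennreal r"
  shows "2 * r + (2 * (lam 0 powr (s - 1) * force_moment u0 / lam 0) + T) \<le> growth_constant * (1 + r)"
proof -
  let ?d = "drift_moment / (lam 0 - L)\<^sup>2"
  let ?l = "lam 0 powr (s - 1) / lam 0"
  let ?f = "2 * L\<^sup>2 * (lam 0 powr (- s) + ?d) + 2 * drift_moment"
  have d: "0 \<le> ?d" and l: "0 \<le> ?l"
    using drift_moment_nonneg lam_0_pos by auto
  have "ennreal ((norm u0)\<^sup>2) \<le> ennreal (lam 0 powr (- s) * r)"
    using norm_sq_le_sobolev_sq[OF s_nonneg, of u0] r u0 by (simp add: ennreal_mult)
  then have "(norm u0)\<^sup>2 \<le> lam 0 powr (- s) * r"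
    using r by (simp add: ennreal_le_iff)
  also have "\<dots> \<le> lam 0 powr (- s) * (1 + r)"
    by (intro mult_left_mono) auto
  finally have u: "(norm u0)\<^sup>2 \<le> lam 0 powr (- s) * (1 + r)" .
  have mono: "y \<le> y * (1 + r)" if "0 \<le> y" for y :: real
    using mult_nonneg_nonneg[OF that r] by (simp add: distrib_left)
  have "force_moment u0 \<le> 2 * L\<^sup>2 * (lam 0 powr (- s) * (1 + r) + ?d * (1 + r)) + 2 * (drift_moment * (1 + r))"
    unfolding force_moment_def
    by (intro add_mono mult_left_mono u mono d drift_moment_nonneg) auto
  also have "\<dots> = ?f * (1 + r)"
    by (simp only: distrib_left distrib_right mult.assoc)
  finally have "?l * force_moment u0 \<le> ?l * (?f * (1 + r))"
    using l by (intro mult_left_mono) auto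
  moreover have "T \<le> T * (1 + r)"
    using T_nonneg by (rule mono)
  moreover have "growth_constant * (1 + r) = 2 * (1 + r) + 2 * (?l * (?f * (1 + r))) + T * (1 + r)"
    by (simp only: growth_constant_def distrib_right mult.assoc)
  moreover have "lam 0 powr (s - 1) * force_moment u0 / lam 0 = ?l * force_moment u0"
    by simp
  moreover have "2 * r + (2 * k + T) \<le> g"
    if "k' \<le> m" "T \<le> t" "g = 2 * (1 + r) + 2 * m + t" "k = k'" for k k' m t g :: real
    using that by (simp add: distrib_left)
  ultimately show ?thesis by blast
qed

end

section \<open>The stochastic convolution\<close>

text \<open>The noise enters only through the coordinates of \<open>X n\<close>, which stands for \<open>J\<^sub>2 \<xi>\<^sub>n\<close>.\<close>

locale noisy_scheme = dissipative_drift e D A lam F L s T + prob_space M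
  for e :: "nat \<Rightarrow> 'a::{real_inner, polish_space}" and D A lam F L s T and M :: "'w measure" +
  fixes h :: real
    and q :: "nat \<Rightarrow> real" and \<xi> :: "nat \<Rightarrow> nat \<Rightarrow> 'w \<Rightarrow> real" and X :: "nat \<Rightarrow> 'w \<Rightarrow> 'a"
  assumes trace_le: "(\<Sum>p. ennreal (lam p powr (s - 1) * q p)) \<le> ennreal T"
    and q_nonneg: "\<And>p. 0 \<le> q p"
    and h_pos: "0 < h"
    and X_measurable [measurable]: "\<And>n. X n \<in> borel_measurable M"
    and \<xi>_orthonormal: "\<And>p. orthonormal_variables (\<lambda>n. \<xi> n p)"
    and X_coordinate: "\<And>n p. AE \<omega> in M.
      X n \<omega> \<bullet> e p = 1 / (1 + (3 - sqrt 2) / 2 * h * lam p) * sqrt (q p) * \<xi> n p \<omega>"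
begin

abbreviation J :: "'a \<Rightarrow> 'a" where "J \<equiv> resolvent D A h"

definition j :: "nat \<Rightarrow> real" where "j p = 1 / (1 + h * lam p)"

text \<open>The scheme without drift and with zero initial value. It carries all the roughness of the noise.\<close>

definition stochastic_convolution :: "nat \<Rightarrow> 'w \<Rightarrow> 'a" where
  "stochastic_convolution = scheme (\<lambda>_. 0) J X h 0"

lemmas xi_measurable [measurable] = orthonormal_variables_measurable[OF \<xi>_orthonormal]

lemma J_coordinate: "J x \<bullet> e p = j p * (x \<bullet> e p)"
  by (simp add: resolvent_coordinate h_pos j_def)

lemma J_linear: "bounded_linear J"
  by (rule bounded_linear_resolvent[OF h_pos])

lemma J_measurable [measurable]: "J \<in> borel_measurable borel"
  by (intro borel_measurable_continuous_onI linear_continuous_on J_linear)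

lemma F_measurable [measurable]: "F \<in> borel_measurable borel"
proof (intro borel_measurable_continuous_onI)
  have "L-lipschitz_on UNIV F"
    using F_lipschitz L_nonneg by (intro lipschitz_onI) (auto simp: dist_norm)
  then show "continuous_on UNIV F"
    by (rule lipschitz_on_continuous_on)
qed

lemma scheme_measurable [measurable]:
  assumes [measurable]: "G \<in> borel_measurable borel"
  shows "scheme G J X h u0 n \<in> borel_measurable M"
proof (induction n)
  case 0
  have "scheme G J X h u0 0 = (\<lambda>_. u0)"
    by (rule ext) simp
  then show ?case by simp
next
  case (Suc n)
  note Suc [measurable]
  show ?case
    unfolding measurable_cong[OF scheme.simps(2)[of G J X h u0 n]] by measurable
qed

lemma stochastic_convolution_measurable [measurable]: "stochastic_convolution n \<in> borel_measurable M"
  unfolding stochastic_convolution_def by measurable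

text \<open>The weights \<open>(sqrt 2 - 1) / 2\<close> and \<open>(3 - sqrt 2) / 2\<close> add up to 1, and the second one is also the
parameter of \<open>J\<^sub>2\<close>. The two injections of noise therefore combine to the factor \<open>J\<^sub>1\<close> alone, and the
recursion becomes that of the implicit Euler scheme, which is solved explicitly.\<close>

lemma stochastic_convolution_coordinate:
  "AE \<omega> in M. stochastic_convolution n \<omega> \<bullet> e p = (\<Sum>k<n. \<xi> k p \<omega> *\<^sub>R (j p ^ (n - k) * sqrt (h * q p)))"
proof (induction n)
  case 0
  then show ?case by (simp add: stochastic_convolution_def)
next
  case (Suc n)
  let ?b = "(3 - sqrt 2) / 2"
  have cancel: "j p * ((sqrt 2 - 1) / 2 * (1 / (1 + ?b * h * lam p))) + ?b * (1 / (1 + ?b * h * lam p)) = j p"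
  proof -
    have b: "0 < ?b"
      using real_sqrt_less_mono[of 2 9] by simp
    have pos: "0 < 1 + h * lam p" "0 < 1 + ?b * h * lam p"
      using h_pos lam_pos[of p] b by (auto intro!: add_pos_pos mult_pos_pos)
    have "j p * ((sqrt 2 - 1) / 2) + ?b = j p * (1 + ?b * h * lam p)"
    proof -
      have "j p * (1 + h * lam p) = 1"
        using pos by (simp add: j_def)
      then have "?b = j p * (1 + h * lam p) * ?b" by simp
      then show ?thesis by (simp add: algebra_simps) (simp add: field_simps)
    qed
    then have "(j p * ((sqrt 2 - 1) / 2) + ?b) * (1 / (1 + ?b * h * lam p)) = j p"
      using pos by simp
    then show ?thesis by (simp add: algebra_simps)
  qed
  show ?case
    using Suc.IH X_coordinate[of n p]
  proof eventually_elim
    case (elim \<omega>)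
    define y where "y = sqrt (q p) * \<xi> n p \<omega>"
    let ?r = "1 / (1 + ?b * h * lam p)"
    have X: "X n \<omega> \<bullet> e p = ?r * y"
      using elim(2) by (simp add: y_def)
    have "stochastic_convolution (Suc n) \<omega> \<bullet> e p
        = j p * (stochastic_convolution n \<omega> \<bullet> e p + (sqrt 2 - 1) / 2 * sqrt h * (?r * y)) + ?b * sqrt h * (?r * y)"
      by (simp add: stochastic_convolution_def inner_add_left J_coordinate X)
    also have "\<dots> = j p * (stochastic_convolution n \<omega> \<bullet> e p)
        + (j p * ((sqrt 2 - 1) / 2 * ?r) + ?b * ?r) * (sqrt h * y)"
    proof -
      have "c * (z + a * w * (r * y)) + b * w * (r * y) = c * z + (c * (a * r) + b * r) * (w * y)"
        for a b c r w y z :: real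
        by (simp add: algebra_simps)
      then show ?thesis .
    qed
    also have "\<dots> = j p * (stochastic_convolution n \<omega> \<bullet> e p + sqrt h * y)"
      unfolding cancel by (simp add: distrib_left)
    also have "\<dots> = (\<Sum>k<n. \<xi> k p \<omega> *\<^sub>R (j p ^ (Suc n - k) * sqrt (h * q p)))
        + \<xi> n p \<omega> *\<^sub>R (j p * sqrt (h * q p))"
    proof -
      have "j p * (\<Sum>k<n. \<xi> k p \<omega> *\<^sub>R (j p ^ (n - k) * sqrt (h * q p)))
          = (\<Sum>k<n. \<xi> k p \<omega> *\<^sub>R (j p ^ (Suc n - k) * sqrt (h * q p)))"
        unfolding sum_distrib_left by (intro sum.cong) (auto simp: Suc_diff_le)
      then show ?thesis
        unfolding elim(1) distrib_left by (simp add: y_def real_sqrt_mult)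
    qed
    finally show ?case by simp
  qed
qed

text \<open>A geometric sum; its bound \<open>q / (2 lam)\<close> is the variance of the invariant law of the
continuous-time Ornstein--Uhlenbeck process in this coordinate, uniformly in the time step.\<close>

lemma stochastic_convolution_second_moment:
  "(\<integral>\<^sup>+ \<omega>. ennreal ((stochastic_convolution n \<omega> \<bullet> e p)\<^sup>2) \<partial>M) \<le> ennreal (q p / (2 * lam p))"
proof -
  have hl: "0 < h * lam p"
    using h_pos lam_pos by simp
  \<comment> \<open>The bound is stable under the recursion \<open>x \<mapsto> (j p)\<^sup>2 (x + 1)\<close>, because \<open>1 + 2 a \<le> (1 + a)\<^sup>2\<close> for \<open>a = h lam\<close>.\<close>
  have geometric: "(\<Sum>k<n. (j p ^ (n - k))\<^sup>2) \<le> 1 / (2 * (h * lam p))"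
  proof (induction n)
    case 0
    then show ?case using hl by simp
  next
    case (Suc n)
    have "(\<Sum>k<Suc n. (j p ^ (Suc n - k))\<^sup>2) = (j p)\<^sup>2 * ((\<Sum>k<n. (j p ^ (n - k))\<^sup>2) + 1)"
      by (simp add: distrib_left sum_distrib_left Suc_diff_le power_mult_distrib)
    also have "\<dots> \<le> (j p)\<^sup>2 * (1 / (2 * (h * lam p)) + 1)"
      using Suc.IH by (intro mult_left_mono) auto
    also have "\<dots> = (1 + 2 * (h * lam p)) / (1 + h * lam p)\<^sup>2 * (1 / (2 * (h * lam p)))"
      using h_pos lam_pos[of p] by (simp add: j_def power_divide add_divide_distrib distrib_left)
    also have "\<dots> \<le> 1 * (1 / (2 * (h * lam p)))"
    proof (intro mult_right_mono)
      have "1 + 2 * (h * lam p) \<le> (1 + h * lam p)\<^sup>2"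
        by (simp add: power2_sum)
      moreover have "0 < (1 + h * lam p)\<^sup>2"
        using hl by simp
      ultimately show "(1 + 2 * (h * lam p)) / (1 + h * lam p)\<^sup>2 \<le> 1"
        by (simp only: divide_le_eq_1_pos)
    qed (use hl in simp)
    finally show ?case by simp
  qed
  have "(\<integral>\<^sup>+ \<omega>. ennreal ((stochastic_convolution n \<omega> \<bullet> e p)\<^sup>2) \<partial>M)
      = (\<integral>\<^sup>+ \<omega>. ennreal ((norm (\<Sum>k<n. \<xi> k p \<omega> *\<^sub>R (j p ^ (n - k) * sqrt (h * q p))))\<^sup>2) \<partial>M)"
    by (rule nn_integral_cong_AE, use stochastic_convolution_coordinate[of n p] in eventually_elim) simp
  also have "\<dots> = ennreal (\<Sum>k<n. (norm (j p ^ (n - k) * sqrt (h * q p)))\<^sup>2)"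
    by (rule orthonormal_variables_pythagoras[OF \<xi>_orthonormal]) simp
  also have "(\<Sum>k<n. (norm (j p ^ (n - k) * sqrt (h * q p)))\<^sup>2) = h * q p * (\<Sum>k<n. (j p ^ (n - k))\<^sup>2)"
    using h_pos q_nonneg[of p] by (simp add: power_mult_distrib sum_distrib_left mult.commute)
  also have "ennreal \<dots> \<le> ennreal (h * q p * (1 / (2 * (h * lam p))))"
    using h_pos q_nonneg[of p] geometric by (intro ennreal_leI mult_left_mono) auto
  also have "h * q p * (1 / (2 * (h * lam p))) = q p / (2 * lam p)"
    using h_pos by simp
  finally show ?thesis .
qed

text \<open>The smoothing by \<open>J\<^sub>2\<close> trades the factor \<open>h\<close> for a factor \<open>1 / lam\<close>, which is what the trace condition
needs.\<close>

lemma scaled_noise_second_moment: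
  "(\<integral>\<^sup>+ \<omega>. ennreal ((((1/2 * sqrt h) *\<^sub>R X n \<omega>) \<bullet> e p)\<^sup>2) \<partial>M) \<le> ennreal (q p / (2 * lam p))"
proof -
  let ?b = "(3 - sqrt 2) / 2"
  let ?r = "1 / (1 + ?b * h * lam p)"
  let ?c = "1/2 * sqrt h * (?r * sqrt (q p))"
  \<comment> \<open>Only \<open>(3 - sqrt 2) / 2 \<ge> 1 / 2\<close> is used, so that the denominator dominates \<open>(1 + h lam / 2)\<^sup>2\<close>.\<close>
  have "sqrt 2 < sqrt (9 / 4)"
    by (intro real_sqrt_less_mono) simp
  then have "sqrt 2 < 3 / 2"
    by (simp add: real_sqrt_divide)
  then have b: "1 / 2 \<le> ?b" by simp
  have hl: "0 < h * lam p"
    using h_pos lam_pos by simp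
  have bhl: "1 / 2 * (h * lam p) \<le> ?b * (h * lam p)"
    using b hl by (intro mult_right_mono) auto
  have "h * lam p \<le> 2 * (1 + ?b * h * lam p)\<^sup>2"
  proof -
    have "1 + h * lam p \<le> (1 + 1 / 2 * (h * lam p))\<^sup>2"
      by (simp add: power2_sum)
    also have "\<dots> \<le> (1 + ?b * h * lam p)\<^sup>2"
      using hl bhl by (intro power_mono) (auto simp: mult.assoc)
    finally show ?thesis using hl by simp
  qed
  then have r: "h * ?r\<^sup>2 \<le> 2 / lam p"
    using lam_pos[of p] bhl hl by (simp add: power_divide field_simps)
  have "(\<integral>\<^sup>+ \<omega>. ennreal ((((1/2 * sqrt h) *\<^sub>R X n \<omega>) \<bullet> e p)\<^sup>2) \<partial>M)
      = (\<integral>\<^sup>+ \<omega>. ennreal ((norm (\<Sum>k\<in>{n}. \<xi> k p \<omega> *\<^sub>R ?c))\<^sup>2) \<partial>M)"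
    by (rule nn_integral_cong_AE, use X_coordinate[of n p] in eventually_elim)
      (simp only: inner_scaleR_left sum.insert sum.empty finite.emptyI empty_iff not_False_eq_True
        add_0_left add_0_right real_scaleR_def real_norm_def power2_abs ac_simps)
  also have "\<dots> = ennreal (\<Sum>k\<in>{n}. (norm ?c)\<^sup>2)"
    by (rule orthonormal_variables_pythagoras[OF \<xi>_orthonormal]) simp
  also have "(\<Sum>k\<in>{n}. (norm ?c)\<^sup>2) = 1 / 4 * (h * ?r\<^sup>2) * q p"
  proof -
    have "(norm (1/2 * sqrt h * (x * sqrt (q p))))\<^sup>2 = 1 / 4 * (h * x\<^sup>2) * q p" for x
      using h_pos q_nonneg[of p] by (simp add: power_mult_distrib power_divide)
    from this[of ?r] show ?thesis by simp
  qed
  also have "ennreal \<dots> \<le> ennreal (1 / 4 * (2 / lam p) * q p)"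
    using r q_nonneg[of p] by (intro ennreal_leI mult_right_mono mult_left_mono) auto
  finally show ?thesis by (simp add: ac_simps)
qed

text \<open>Moments of order \<open>q p / lam p\<close> in every coordinate are exactly what the trace condition can sum
against the weights of \<open>H\<^sup>s\<close>.\<close>

lemma sobolev_moment_le:
  assumes [measurable]: "Y \<in> borel_measurable M" and c: "0 \<le> c"
    and le: "\<And>p. (\<integral>\<^sup>+ \<omega>. ennreal ((Y \<omega> \<bullet> e p)\<^sup>2) \<partial>M) \<le> ennreal (c * (q p / lam p))"
  shows "(\<integral>\<^sup>+ \<omega>. sobolev_sq lam e s (Y \<omega>) \<partial>M) \<le> ennreal (c * T)"
proof -
  have "(\<integral>\<^sup>+ \<omega>. sobolev_sq lam e s (Y \<omega>) \<partial>M)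
      = (\<Sum>p. ennreal (lam p powr s) * (\<integral>\<^sup>+ \<omega>. ennreal ((Y \<omega> \<bullet> e p)\<^sup>2) \<partial>M))"
    unfolding sobolev_sq_def by (subst nn_integral_suminf) (auto simp: ennreal_mult nn_integral_cmult)
  also have "\<dots> \<le> (\<Sum>p. ennreal (lam p powr s) * ennreal (c * (q p / lam p)))"
    by (intro suminf_le summableI mult_left_mono le) auto
  also have "\<dots> = (\<Sum>p. ennreal c * ennreal (lam p powr (s - 1) * q p))"
  proof (intro suminf_cong)
    fix p
    have "lam p powr s * (c * (q p / lam p)) = c * (lam p powr (s - 1) * q p)"
      using lam_pos[of p] by (simp add: powr_diff)
    then show "ennreal (lam p powr s) * ennreal (c * (q p / lam p)) = ennreal c * ennreal (lam p powr (s - 1) * q p)"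
      using c q_nonneg[of p] lam_pos[of p] by (simp add: ennreal_mult[symmetric] less_imp_le)
  qed
  also have "\<dots> = ennreal c * (\<Sum>p. ennreal (lam p powr (s - 1) * q p))"
    by simp
  also have "\<dots> \<le> ennreal c * ennreal T"
    by (intro mult_left_mono trace_le) simp
  finally show ?thesis
    using c T_nonneg by (simp add: ennreal_mult)
qed

lemma stochastic_convolution_sobolev_moment: "(\<integral>\<^sup>+ \<omega>. sobolev_sq lam e s (stochastic_convolution n \<omega>) \<partial>M) \<le> ennreal (1/2 * T)"
  using stochastic_convolution_second_moment[of n] by (intro sobolev_moment_le) auto

lemma scaled_noise_sobolev_moment:
  "(\<integral>\<^sup>+ \<omega>. sobolev_sq lam e s ((1/2 * sqrt h) *\<^sub>R X n \<omega>) \<partial>M) \<le> ennreal (1/2 * T)"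
  using scaled_noise_second_moment[of n] by (intro sobolev_moment_le) auto

lemma norm_moment_le:
  assumes [measurable]: "Y \<in> borel_measurable M"
    and le: "(\<integral>\<^sup>+ \<omega>. sobolev_sq lam e s (Y \<omega>) \<partial>M) \<le> ennreal (1/2 * T)"
  shows "(\<integral>\<^sup>+ \<omega>. ennreal ((norm (Y \<omega>))\<^sup>2) \<partial>M) \<le> ennreal (lam 0 powr (- s) * T / 2)"
proof -
  have "(\<integral>\<^sup>+ \<omega>. ennreal ((norm (Y \<omega>))\<^sup>2) \<partial>M)
      \<le> (\<integral>\<^sup>+ \<omega>. ennreal (lam 0 powr (- s)) * sobolev_sq lam e s (Y \<omega>) \<partial>M)"
    by (intro nn_integral_mono norm_sq_le_sobolev_sq s_nonneg)
  also have "\<dots> = ennreal (lam 0 powr (- s)) * (\<integral>\<^sup>+ \<omega>. sobolev_sq lam e s (Y \<omega>) \<partial>M)"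
    by (rule nn_integral_cmult) measurable
  also have "\<dots> \<le> ennreal (lam 0 powr (- s)) * ennreal (1/2 * T)"
    by (intro mult_left_mono le) simp
  finally show ?thesis
    using T_nonneg by (simp add: ennreal_mult[symmetric])
qed

section \<open>The remainder\<close>

text \<open>The random shift at which the drift is evaluated along the remainder.\<close>

definition forcing :: "nat \<Rightarrow> 'w \<Rightarrow> 'a" where
  "forcing n \<omega> = stochastic_convolution n \<omega> + (1/2 * sqrt h) *\<^sub>R X n \<omega>"

text \<open>What is left of the scheme after the stochastic convolution is removed: it evolves without any
additive noise, so it is estimated path by path.\<close>

definition remainder :: "'a \<Rightarrow> nat \<Rightarrow> 'w \<Rightarrow> 'a" where
  "remainder u0 n \<omega> = scheme F J X h u0 n \<omega> - stochastic_convolution n \<omega>"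

definition drift_bound :: "nat \<Rightarrow> 'w \<Rightarrow> real" where
  "drift_bound n \<omega> = norm (F 0) + L * norm (forcing n \<omega>)"

lemma remainder_measurable [measurable]: "remainder u0 n \<in> borel_measurable M"
  unfolding remainder_def by measurable

lemma forcing_measurable [measurable]: "forcing n \<in> borel_measurable M"
  unfolding forcing_def by measurable

lemma drift_bound_measurable [measurable]: "drift_bound n \<in> borel_measurable M"
  unfolding drift_bound_def by measurable

lemma remainder_0: "remainder u0 0 \<omega> = u0"
  by (simp add: remainder_def stochastic_convolution_def)

lemma remainder_Suc:
  "remainder u0 (Suc n) \<omega> = J (remainder u0 n \<omega> + h *\<^sub>R F (remainder u0 n \<omega> + forcing n \<omega>))"
proof -
  interpret J: bounded_linear J by (rule J_linear)
  show ?thesis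
    by (simp add: remainder_def forcing_def stochastic_convolution_def J.add J.diff)
qed

lemma drift_norm_le:
  "norm (F (remainder u0 n \<omega> + forcing n \<omega>)) \<le> L * norm (remainder u0 n \<omega>) + drift_bound n \<omega>"
proof -
  let ?x = "remainder u0 n \<omega>" and ?y = "forcing n \<omega>"
  have "norm (F (?x + ?y)) \<le> norm (F 0) + norm (F (?x + ?y) - F 0)"
    by (metis add.commute norm_triangle_sub)
  also have "\<dots> \<le> norm (F 0) + L * norm (?x + ?y)"
    using F_lipschitz[of "?x + ?y" 0] by simp
  also have "\<dots> \<le> norm (F 0) + L * (norm ?x + norm ?y)"
    using L_nonneg by (intro add_left_mono mult_left_mono norm_triangle_ineq) auto
  finally show ?thesis
    by (simp add: drift_bound_def distrib_left)
qed

lemma drift_bound_moment: "(\<integral>\<^sup>+ \<omega>. ennreal ((drift_bound n \<omega>)\<^sup>2) \<partial>M) \<le> ennreal drift_moment"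
proof -
  let ?t = "lam 0 powr (- s) * T"
  let ?N = "\<lambda>\<omega>. (1/2 * sqrt h) *\<^sub>R X n \<omega>"
  have t: "0 \<le> ?t" using T_nonneg by simp
  have "(drift_bound n \<omega>)\<^sup>2
      \<le> 2 * (norm (F 0))\<^sup>2 + 4 * L\<^sup>2 * (norm (stochastic_convolution n \<omega>))\<^sup>2 + 4 * L\<^sup>2 * (norm (?N \<omega>))\<^sup>2" for \<omega>
  proof -
    have "(norm (forcing n \<omega>))\<^sup>2 \<le> (norm (stochastic_convolution n \<omega>) + norm (?N \<omega>))\<^sup>2"
      unfolding forcing_def by (intro power_mono norm_triangle_ineq) simp
    also have "\<dots> \<le> 2 * (norm (stochastic_convolution n \<omega>))\<^sup>2 + 2 * (norm (?N \<omega>))\<^sup>2"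
      by (rule square_sum_le)
    finally have "2 * L\<^sup>2 * (norm (forcing n \<omega>))\<^sup>2
        \<le> 2 * L\<^sup>2 * (2 * (norm (stochastic_convolution n \<omega>))\<^sup>2 + 2 * (norm (?N \<omega>))\<^sup>2)"
      by (intro mult_left_mono) auto
    moreover have "(drift_bound n \<omega>)\<^sup>2 \<le> 2 * (norm (F 0))\<^sup>2 + 2 * (L * norm (forcing n \<omega>))\<^sup>2"
      unfolding drift_bound_def by (rule square_sum_le)
    ultimately show ?thesis
      by (simp only: power_mult_distrib distrib_left mult.assoc)
  qed
  then have "(\<integral>\<^sup>+ \<omega>. ennreal ((drift_bound n \<omega>)\<^sup>2) \<partial>M)
      \<le> (\<integral>\<^sup>+ \<omega>. ennreal (2 * (norm (F 0))\<^sup>2) + ennreal (4 * L\<^sup>2) * ennreal ((norm (stochastic_convolution n \<omega>))\<^sup>2)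
          + ennreal (4 * L\<^sup>2) * ennreal ((norm (?N \<omega>))\<^sup>2) \<partial>M)"
    by (intro nn_integral_mono)
      (simp add: ennreal_mult[symmetric] ennreal_plus[symmetric] ennreal_leI del: ennreal_plus norm_scaleR)
  also have "\<dots> = ennreal (2 * (norm (F 0))\<^sup>2)
      + ennreal (4 * L\<^sup>2) * (\<integral>\<^sup>+ \<omega>. ennreal ((norm (stochastic_convolution n \<omega>))\<^sup>2) \<partial>M)
      + ennreal (4 * L\<^sup>2) * (\<integral>\<^sup>+ \<omega>. ennreal ((norm (?N \<omega>))\<^sup>2) \<partial>M)"
    by (simp add: nn_integral_add nn_integral_cmult emeasure_space_1 del: norm_scaleR)
  also have "\<dots> \<le> ennreal (2 * (norm (F 0))\<^sup>2) + ennreal (4 * L\<^sup>2) * ennreal (?t / 2)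
      + ennreal (4 * L\<^sup>2) * ennreal (?t / 2)"
    by (intro add_mono mult_left_mono norm_moment_le stochastic_convolution_sobolev_moment
        scaled_noise_sobolev_moment order_refl) auto
  also have "\<dots> = ennreal (2 * (norm (F 0))\<^sup>2 + 4 * L\<^sup>2 * (?t / 2) + 4 * L\<^sup>2 * (?t / 2))"
  proof -
    have sum_eq: "ennreal a + ennreal b * ennreal c + ennreal b * ennreal c = ennreal (a + b * c + b * c)"
      if "0 \<le> a" "0 \<le> b" "0 \<le> c" for a b c
      using that by (simp only: ennreal_plus ennreal_mult mult_nonneg_nonneg add_nonneg_nonneg)
    show ?thesis
      by (rule sum_eq) (use T_nonneg in auto)
  qed
  also have "2 * (norm (F 0))\<^sup>2 + 4 * L\<^sup>2 * (?t / 2) + 4 * L\<^sup>2 * (?t / 2) = drift_moment"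
    by (simp add: drift_moment_def)
  finally show ?thesis .
qed

text \<open>Squaring the pathwise estimate \<open>(1 + h lam) |v'| \<le> (1 + h L) |v| + h G\<close> with Cauchy--Schwarz, where the
weights are chosen so that they add up to \<open>1 + h lam\<close> and cancel one factor on the left. The strict
inequality \<open>L < lam 0\<close> is what leaves a positive weight for the term with \<open>G\<close>.\<close>

lemma remainder_norm_step:
  "(1 + h * lam 0) * (norm (remainder u0 (Suc n) \<omega>))\<^sup>2
    \<le> (1 + h * L) * (norm (remainder u0 n \<omega>))\<^sup>2 + h / (lam 0 - L) * (drift_bound n \<omega>)\<^sup>2"
proof -
  define x y where "x = norm (remainder u0 n \<omega>)" and "y = drift_bound n \<omega>"
  define x' where "x' = norm (remainder u0 (Suc n) \<omega>)"
  define d where "d = lam 0 - L"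
  have d: "0 < d" using L_less by (simp add: d_def)
  have l: "0 < 1 + h * lam 0"
    using h_pos lam_0_pos by (simp add: add_pos_pos)
  have "(1 + h * lam 0) * x' \<le> norm (remainder u0 n \<omega> + h *\<^sub>R F (remainder u0 n \<omega> + forcing n \<omega>))"
    unfolding x'_def remainder_Suc by (rule norm_resolvent_le[OF h_pos])
  also have "\<dots> \<le> x + h * norm (F (remainder u0 n \<omega> + forcing n \<omega>))"
    unfolding x_def using h_pos by (metis norm_triangle_ineq norm_scaleR abs_of_pos)
  also have "\<dots> \<le> x + h * (L * x + y)"
    unfolding x_def y_def using h_pos drift_norm_le by (intro add_left_mono mult_left_mono) auto
  finally have "(1 + h * lam 0) * x' \<le> (1 + h * L) * x + h * y"
    by (simp add: algebra_simps)
  then have "((1 + h * lam 0) * x')\<^sup>2 \<le> ((1 + h * L) * x + h * y)\<^sup>2"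
    using l by (intro power_mono mult_nonneg_nonneg) (auto simp: x'_def)
  also have "\<dots> \<le> ((1 + h * L) + h * d) * ((1 + h * L) * x\<^sup>2 + h / d * y\<^sup>2)"
  proof -
    have "((1 + h * L) + h * d) * ((1 + h * L) * x\<^sup>2 + h / d * y\<^sup>2) - ((1 + h * L) * x + h * y)\<^sup>2
        = (1 + h * L) * (h / d) * (d * x - y)\<^sup>2"
      using d by (simp add: field_simps power2_eq_square)
    moreover have "0 \<le> (1 + h * L) * (h / d) * (d * x - y)\<^sup>2"
      using h_pos d L_nonneg by simp
    ultimately show ?thesis by linarith
  qed
  also have "(1 + h * L) + h * d = 1 + h * lam 0"
    by (simp add: d_def algebra_simps)
  finally have "(1 + h * lam 0) * ((1 + h * lam 0) * x'\<^sup>2)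
      \<le> (1 + h * lam 0) * ((1 + h * L) * x\<^sup>2 + h / d * y\<^sup>2)"
    by (simp add: power2_eq_square ac_simps)
  then show ?thesis
    using l unfolding x_def y_def x'_def d_def by (simp only: mult_le_cancel_left_pos)
qed

lemma remainder_norm_moment:
  "(\<integral>\<^sup>+ \<omega>. ennreal ((norm (remainder u0 n \<omega>))\<^sup>2) \<partial>M)
    \<le> ennreal ((norm u0)\<^sup>2 + drift_moment / (lam 0 - L)\<^sup>2)"
proof -
  let ?a = "\<lambda>n. \<integral>\<^sup>+ \<omega>. ennreal ((norm (remainder u0 n \<omega>))\<^sup>2) \<partial>M"
  let ?c = "drift_moment / (lam 0 - L)"
  have c: "0 \<le> ?c"
    using L_less drift_moment_nonneg by simp
  have hl: "0 \<le> 1 + h * lam 0" "0 \<le> 1 + h * L" "0 \<le> h / (lam 0 - L)"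
    using h_pos lam_0_pos L_nonneg L_less by auto
  have "?a n \<le> ?a 0 + ennreal (?c / (lam 0 - L))"
  proof (rule affine_recursion_bounded[OF h_pos L_nonneg L_less c])
    fix n
    have "ennreal (1 + h * lam 0) * ?a (Suc n)
        = (\<integral>\<^sup>+ \<omega>. ennreal (1 + h * lam 0) * ennreal ((norm (remainder u0 (Suc n) \<omega>))\<^sup>2) \<partial>M)"
      by (subst nn_integral_cmult) auto
    also have "\<dots> \<le> (\<integral>\<^sup>+ \<omega>. ennreal (1 + h * L) * ennreal ((norm (remainder u0 n \<omega>))\<^sup>2)
        + ennreal (h / (lam 0 - L)) * ennreal ((drift_bound n \<omega>)\<^sup>2) \<partial>M)"
      using hl remainder_norm_step[of u0 n] by (intro nn_integral_mono)
        (simp add: ennreal_mult[symmetric] ennreal_plus[symmetric] ennreal_leI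
          del: ennreal_plus times_divide_eq_left)
    also have "\<dots> = ennreal (1 + h * L) * ?a n
        + ennreal (h / (lam 0 - L)) * (\<integral>\<^sup>+ \<omega>. ennreal ((drift_bound n \<omega>)\<^sup>2) \<partial>M)"
      by (simp add: nn_integral_add nn_integral_cmult)
    also have "\<dots> \<le> ennreal (1 + h * L) * ?a n + ennreal (h / (lam 0 - L)) * ennreal drift_moment"
      by (intro add_left_mono mult_left_mono drift_bound_moment) auto
    also have "ennreal (h / (lam 0 - L)) * ennreal drift_moment = ennreal (h * ?c)"
      using hl drift_moment_nonneg by (simp add: ennreal_mult[symmetric] del: times_divide_eq_left) simp
    finally show "ennreal (1 + h * lam 0) * ?a (Suc n) \<le> ennreal (1 + h * L) * ?a n + ennreal (h * ?c)" .
  qed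
  also have "?a 0 = ennreal ((norm u0)\<^sup>2)"
    by (simp add: remainder_0 emeasure_space_1)
  also have "ennreal ((norm u0)\<^sup>2) + ennreal (?c / (lam 0 - L))
      = ennreal ((norm u0)\<^sup>2 + drift_moment / (lam 0 - L)\<^sup>2)"
    using drift_moment_nonneg by (simp add: ennreal_plus[symmetric] power2_eq_square del: ennreal_plus)
  finally show ?thesis .
qed

lemma drift_second_moment:
  "(\<integral>\<^sup>+ \<omega>. ennreal ((norm (F (remainder u0 n \<omega> + forcing n \<omega>)))\<^sup>2) \<partial>M) \<le> ennreal (force_moment u0)"
proof -
  let ?m = "(norm u0)\<^sup>2 + drift_moment / (lam 0 - L)\<^sup>2"
  have m: "0 \<le> ?m" using drift_moment_nonneg by simp
  have "(norm (F (remainder u0 n \<omega> + forcing n \<omega>)))\<^sup>2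
      \<le> 2 * L\<^sup>2 * (norm (remainder u0 n \<omega>))\<^sup>2 + 2 * (drift_bound n \<omega>)\<^sup>2" for \<omega>
  proof -
    have "(norm (F (remainder u0 n \<omega> + forcing n \<omega>)))\<^sup>2
        \<le> (L * norm (remainder u0 n \<omega>) + drift_bound n \<omega>)\<^sup>2"
      by (intro power_mono drift_norm_le) simp
    also have "\<dots> \<le> 2 * (L * norm (remainder u0 n \<omega>))\<^sup>2 + 2 * (drift_bound n \<omega>)\<^sup>2"
      by (rule square_sum_le)
    finally show ?thesis by (simp add: power_mult_distrib)
  qed
  then have "(\<integral>\<^sup>+ \<omega>. ennreal ((norm (F (remainder u0 n \<omega> + forcing n \<omega>)))\<^sup>2) \<partial>M)
      \<le> (\<integral>\<^sup>+ \<omega>. ennreal (2 * L\<^sup>2) * ennreal ((norm (remainder u0 n \<omega>))\<^sup>2)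
          + ennreal 2 * ennreal ((drift_bound n \<omega>)\<^sup>2) \<partial>M)"
    by (intro nn_integral_mono)
      (simp add: ennreal_mult[symmetric] ennreal_plus[symmetric] ennreal_leI del: ennreal_plus ennreal_numeral)
  also have "\<dots> = ennreal (2 * L\<^sup>2) * (\<integral>\<^sup>+ \<omega>. ennreal ((norm (remainder u0 n \<omega>))\<^sup>2) \<partial>M)
      + ennreal 2 * (\<integral>\<^sup>+ \<omega>. ennreal ((drift_bound n \<omega>)\<^sup>2) \<partial>M)"
    by (simp add: nn_integral_add nn_integral_cmult)
  also have "\<dots> \<le> ennreal (2 * L\<^sup>2) * ennreal ?m + ennreal 2 * ennreal drift_moment"
    by (intro add_mono mult_left_mono remainder_norm_moment drift_bound_moment) auto
  also have "\<dots> = ennreal (force_moment u0)"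
    using m drift_moment_nonneg unfolding force_moment_def
    by (simp add: ennreal_mult[symmetric] ennreal_plus[symmetric] del: ennreal_plus ennreal_numeral)
  finally show ?thesis .
qed

text \<open>The implicit step gains regularity: in a coordinate with eigenvalue \<open>l\<close>, Cauchy--Schwarz gives
\<open>(a + h b)\<^sup>2 \<le> (1 + h l) (a\<^sup>2 + h b\<^sup>2 / l)\<close>, and the factor \<open>1 / l\<close> in front of the drift compensates the
weight \<open>l powr s\<close> as long as \<open>s \<le> 1\<close>. Hence a drift bounded in the plain norm suffices, and no estimate
of the singular kernel of the discrete semigroup is needed.\<close>

lemma resolvent_step_sobolev:
  "ennreal (1 + h * lam 0) * sobolev_sq lam e s (J (x + h *\<^sub>R f))
    \<le> sobolev_sq lam e s x + ennreal (h * lam 0 powr (s - 1)) * ennreal ((norm f)\<^sup>2)"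
proof -
  have coordinate: "(1 + h * lam 0) * (lam p powr s * (J (x + h *\<^sub>R f) \<bullet> e p)\<^sup>2)
      \<le> lam p powr s * (x \<bullet> e p)\<^sup>2 + h * lam 0 powr (s - 1) * (f \<bullet> e p)\<^sup>2" for p
  proof -
    define l a b y where "l = lam p" and "a = x \<bullet> e p" and "b = f \<bullet> e p" and "y = J (x + h *\<^sub>R f) \<bullet> e p"
    have l: "0 < l" "lam 0 \<le> l"
      using lam_pos[of p] lam_0_le[of p] by (auto simp: l_def)
    then have hl: "0 < 1 + h * l"
      using h_pos by (simp add: add_pos_pos)
    have y: "(1 + h * l) * y = a + h * b"
      using hl by (simp add: y_def a_def b_def J_coordinate inner_add_left j_def l_def)
    have "(1 + h * l) * ((1 + h * l) * y\<^sup>2) = (a + h * b)\<^sup>2"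
      unfolding y[symmetric] by (simp add: power2_eq_square ac_simps)
    also have "\<dots> \<le> (1 + h * l) * (a\<^sup>2 + h / l * b\<^sup>2)"
    proof -
      have "(1 + h * l) * (a\<^sup>2 + h / l * b\<^sup>2) - (a + h * b)\<^sup>2 = h / l * (l * a - b)\<^sup>2"
        using l by (simp add: field_simps power2_eq_square)
      moreover have "0 \<le> h / l * (l * a - b)\<^sup>2"
        using h_pos l by simp
      ultimately show ?thesis by linarith
    qed
    finally have step: "(1 + h * l) * y\<^sup>2 \<le> a\<^sup>2 + h / l * b\<^sup>2"
      using hl by (simp only: mult_le_cancel_left_pos)
    have "(1 + h * lam 0) * y\<^sup>2 \<le> (1 + h * l) * y\<^sup>2"
      using h_pos l by (intro mult_right_mono add_left_mono mult_left_mono) auto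
    with step have "l powr s * ((1 + h * lam 0) * y\<^sup>2) \<le> l powr s * (a\<^sup>2 + h / l * b\<^sup>2)"
      by (intro mult_left_mono) auto
    also have "\<dots> = l powr s * a\<^sup>2 + h * l powr (s - 1) * b\<^sup>2"
      using l by (simp add: powr_diff distrib_left)
    also have "\<dots> \<le> l powr s * a\<^sup>2 + h * lam 0 powr (s - 1) * b\<^sup>2"
      using h_pos l lam_0_pos s_le_1
      by (intro add_left_mono mult_right_mono mult_left_mono powr_mono2') auto
    finally show ?thesis
      by (simp add: l_def a_def b_def y_def ac_simps)
  qed
  have hl: "0 \<le> 1 + h * lam 0" "0 \<le> h * lam 0 powr (s - 1)"
    using h_pos lam_0_pos by auto
  have "ennreal (1 + h * lam 0) * sobolev_sq lam e s (J (x + h *\<^sub>R f))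
      = (\<Sum>p. ennreal (1 + h * lam 0) * ennreal (lam p powr s * (J (x + h *\<^sub>R f) \<bullet> e p)\<^sup>2))"
    by (simp add: sobolev_sq_def)
  also have "\<dots> \<le> (\<Sum>p. ennreal (lam p powr s * (x \<bullet> e p)\<^sup>2)
      + ennreal (h * lam 0 powr (s - 1)) * ennreal ((f \<bullet> e p)\<^sup>2))"
  proof (intro suminf_le summableI)
    fix p
    have "ennreal (1 + h * lam 0) * ennreal (lam p powr s * (J (x + h *\<^sub>R f) \<bullet> e p)\<^sup>2)
        = ennreal ((1 + h * lam 0) * (lam p powr s * (J (x + h *\<^sub>R f) \<bullet> e p)\<^sup>2))"
      using hl by (simp only: ennreal_mult')
    also have "\<dots> \<le> ennreal (lam p powr s * (x \<bullet> e p)\<^sup>2 + h * lam 0 powr (s - 1) * (f \<bullet> e p)\<^sup>2)"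
      by (intro ennreal_leI coordinate)
    also have "\<dots> = ennreal (lam p powr s * (x \<bullet> e p)\<^sup>2)
        + ennreal (h * lam 0 powr (s - 1)) * ennreal ((f \<bullet> e p)\<^sup>2)"
      using hl by (subst ennreal_plus) (auto simp: ennreal_mult)
    finally show "ennreal (1 + h * lam 0) * ennreal (lam p powr s * (J (x + h *\<^sub>R f) \<bullet> e p)\<^sup>2)
        \<le> ennreal (lam p powr s * (x \<bullet> e p)\<^sup>2) + ennreal (h * lam 0 powr (s - 1)) * ennreal ((f \<bullet> e p)\<^sup>2)" .
  qed
  also have "\<dots> = sobolev_sq lam e s x + ennreal (h * lam 0 powr (s - 1)) * (\<Sum>p. ennreal ((f \<bullet> e p)\<^sup>2))"
    unfolding sobolev_sq_def ennreal_suminf_cmult[symmetric]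
    by (rule suminf_add[symmetric]) (rule summableI)+
  also have "(\<Sum>p. ennreal ((f \<bullet> e p)\<^sup>2)) = ennreal ((norm f)\<^sup>2)"
    by (rule suminf_ennreal_eq[OF _ norm_sums]) simp
  finally show ?thesis .
qed

lemma remainder_sobolev_moment:
  "(\<integral>\<^sup>+ \<omega>. sobolev_sq lam e s (remainder u0 n \<omega>) \<partial>M)
    \<le> sobolev_sq lam e s u0 + ennreal (lam 0 powr (s - 1) * force_moment u0 / lam 0)"
proof -
  let ?a = "\<lambda>n. \<integral>\<^sup>+ \<omega>. sobolev_sq lam e s (remainder u0 n \<omega>) \<partial>M"
  let ?l = "lam 0 powr (s - 1)"
  let ?f = "\<lambda>n \<omega>. F (remainder u0 n \<omega> + forcing n \<omega>)"
  have c: "0 \<le> ?l * force_moment u0"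
    using force_moment_nonneg by simp
  have "?a n \<le> ?a 0 + ennreal (?l * force_moment u0 / (lam 0 - 0))"
  proof (rule affine_recursion_bounded[OF h_pos order_refl lam_0_pos c])
    fix n
    have "ennreal (1 + h * lam 0) * ?a (Suc n)
        = (\<integral>\<^sup>+ \<omega>. ennreal (1 + h * lam 0) * sobolev_sq lam e s (remainder u0 (Suc n) \<omega>) \<partial>M)"
      by (subst nn_integral_cmult) auto
    also have "\<dots> \<le> (\<integral>\<^sup>+ \<omega>. sobolev_sq lam e s (remainder u0 n \<omega>)
        + ennreal (h * ?l) * ennreal ((norm (?f n \<omega>))\<^sup>2) \<partial>M)"
      unfolding remainder_Suc by (intro nn_integral_mono resolvent_step_sobolev)
    also have "\<dots> = ?a n + ennreal (h * ?l) * (\<integral>\<^sup>+ \<omega>. ennreal ((norm (?f n \<omega>))\<^sup>2) \<partial>M)"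
      by (simp add: nn_integral_add nn_integral_cmult)
    also have "\<dots> \<le> ?a n + ennreal (h * ?l) * ennreal (force_moment u0)"
      by (intro add_left_mono mult_left_mono drift_second_moment) auto
    also have "\<dots> = ennreal (1 + h * 0) * ?a n + ennreal (h * (?l * force_moment u0))"
      using h_pos force_moment_nonneg[of u0] by (simp add: ennreal_mult[symmetric] ac_simps)
    finally show "ennreal (1 + h * lam 0) * ?a (Suc n)
        \<le> ennreal (1 + h * 0) * ?a n + ennreal (h * (?l * force_moment u0))" .
  qed
  then show ?thesis
    by (simp add: remainder_0 emeasure_space_1)
qed

lemma scheme_sobolev_moment:
  "(\<integral>\<^sup>+ \<omega>. sobolev_sq lam e s (scheme F J X h u0 n \<omega>) \<partial>M)
    \<le> 2 * sobolev_sq lam e s u0 + ennreal (2 * (lam 0 powr (s - 1) * force_moment u0 / lam 0) + T)"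
proof -
  let ?k = "lam 0 powr (s - 1) * force_moment u0 / lam 0"
  have k: "0 \<le> ?k"
    using force_moment_nonneg lam_0_pos by simp
  have "scheme F J X h u0 n \<omega> = remainder u0 n \<omega> + stochastic_convolution n \<omega>" for \<omega>
    by (simp add: remainder_def)
  then have "(\<integral>\<^sup>+ \<omega>. sobolev_sq lam e s (scheme F J X h u0 n \<omega>) \<partial>M)
      \<le> (\<integral>\<^sup>+ \<omega>. 2 * sobolev_sq lam e s (remainder u0 n \<omega>) + 2 * sobolev_sq lam e s (stochastic_convolution n \<omega>) \<partial>M)"
    by (intro nn_integral_mono) (simp only: sobolev_sq_add_le)
  also have "\<dots> = 2 * (\<integral>\<^sup>+ \<omega>. sobolev_sq lam e s (remainder u0 n \<omega>) \<partial>M)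
      + 2 * (\<integral>\<^sup>+ \<omega>. sobolev_sq lam e s (stochastic_convolution n \<omega>) \<partial>M)"
    by (simp add: nn_integral_add nn_integral_cmult)
  also have "\<dots> \<le> 2 * (sobolev_sq lam e s u0 + ennreal ?k) + 2 * ennreal (1/2 * T)"
    by (intro add_mono mult_left_mono remainder_sobolev_moment stochastic_convolution_sobolev_moment) auto
  also have "\<dots> = 2 * sobolev_sq lam e s u0 + (ennreal 2 * ennreal ?k + ennreal 2 * ennreal (1/2 * T))"
    by (simp add: distrib_left add.assoc)
  also have "ennreal 2 * ennreal ?k + ennreal 2 * ennreal (1/2 * T) = ennreal (2 * ?k + T)"
    using k T_nonneg
    by (simp add: ennreal_mult[symmetric] ennreal_plus[symmetric] del: ennreal_plus ennreal_numeral)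
  finally show ?thesis .
qed

end

section \<open>First moments, Lipschitz constants and covariances\<close>

lemma (in prob_space) expected_H_norm_le:
  fixes Y :: "'a \<Rightarrow> 'b::{real_inner, polish_space}"
  assumes [measurable]: "Y \<in> borel_measurable M" and K: "1 \<le> K" and c: "0 \<le> c"
    and le: "(\<integral>\<^sup>+ \<omega>. sobolev_sq lam e s (Y \<omega>) \<partial>M) \<le> ennreal (c * K\<^sup>2)"
  shows "(\<integral>\<^sup>+ \<omega>. H_norm lam e s (Y \<omega>) \<partial>M) \<le> ennreal ((1 + c) * K)"
proof -
  have "(\<integral>\<^sup>+ \<omega>. H_norm lam e s (Y \<omega>) \<partial>M)
      \<le> (\<integral>\<^sup>+ \<omega>. ennreal K + ennreal (1 / K) * sobolev_sq lam e s (Y \<omega>) \<partial>M)"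
    using K by (intro nn_integral_mono H_norm_le_sobolev_sq) simp
  also have "\<dots> = ennreal K + ennreal (1 / K) * (\<integral>\<^sup>+ \<omega>. sobolev_sq lam e s (Y \<omega>) \<partial>M)"
    by (simp add: nn_integral_add nn_integral_cmult emeasure_space_1)
  also have "\<dots> \<le> ennreal K + ennreal (1 / K) * ennreal (c * K\<^sup>2)"
    by (intro add_left_mono mult_left_mono le) simp
  also have "\<dots> = ennreal (K + 1 / K * (c * K\<^sup>2))"
    using K c by (subst ennreal_plus) (auto simp: ennreal_mult simp del: times_divide_eq_left)
  also have "K + 1 / K * (c * K\<^sup>2) = (1 + c) * K"
    using K by (simp add: power2_eq_square field_simps)
  finally show ?thesis .
qed

lemma lipschitz_const_properties:
  fixes F :: "'a::real_normed_vector \<Rightarrow> 'a"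
  assumes "\<exists>L. L-lipschitz_on UNIV F"
  shows norm_diff_le_lipschitz_const: "norm (F x - F y) \<le> lipschitz_const F * norm (x - y)"
    and lipschitz_const_nonneg: "(z::'a) \<noteq> 0 \<Longrightarrow> 0 \<le> lipschitz_const F"
proof -
  let ?S = "{norm (F x - F y) / norm (x - y) | x y. x \<noteq> y}"
  obtain L where L: "L-lipschitz_on UNIV F" using assms by blast
  have "bdd_above ?S"
  proof (rule bdd_aboveI[of _ L])
    fix t assume "t \<in> ?S"
    then obtain x y where "t = norm (F x - F y) / norm (x - y)" "x \<noteq> y" by blast
    then show "t \<le> L"
      using lipschitz_onD[OF L, of x y] by (simp add: dist_norm divide_le_eq)
  qed
  then have le: "norm (F x - F y) / norm (x - y) \<le> lipschitz_const F" if "x \<noteq> y" for x y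
    unfolding lipschitz_const_def using that by (intro cSup_upper) auto
  show "norm (F x - F y) \<le> lipschitz_const F * norm (x - y)"
    using le[of x y] by (cases "x = y") (auto simp: divide_le_eq)
  show "0 \<le> lipschitz_const F" if "z \<noteq> 0"
    using order_trans[OF _ le[OF that]] by simp
qed

context negative_diagonal_operator
begin

lemma summable_lower_power:
  assumes t: "summable (\<lambda>p. lam p powr t * q p)" and q: "\<And>p. 0 \<le> q p" and r: "r \<le> t"
  shows "summable (\<lambda>p. lam p powr r * q p)"
proof (rule summable_comparison_test'[OF summable_mult[OF t, of "lam 0 powr (r - t)"]])
  fix p
  have "lam p powr r = lam p powr (r - t) * lam p powr t"
    by (simp add: powr_add[symmetric])
  also have "\<dots> \<le> lam 0 powr (r - t) * lam p powr t"
    using r lam_0_pos lam_0_le by (intro mult_right_mono powr_mono2') auto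
  finally show "norm (lam p powr r * q p) \<le> lam 0 powr (r - t) * (lam p powr t * q p)"
    using q[of p] by (simp add: mult_right_mono mult.assoc[symmetric])
qed

text \<open>The covariance identity, tested on a basis vector. It determines how the variance of a coordinate
is composed, although \<open>J\<close> itself is not known.\<close>

lemma covariance_coordinates:
  assumes J: "bounded_linear J" and Q_sym: "\<And>x y. Q x \<bullet> y = x \<bullet> Q y"
    and Q_basis: "\<And>p. Q (e p) = q p *\<^sub>R e p" and c: "0 < c"
    and cov: "\<And>x. J (Q (adjoint J x)) = resolvent D A c (Q x)"
  shows "(\<lambda>k. q k * (J (e k) \<bullet> e p)\<^sup>2) sums (q p / (1 + c * lam p))"
proof -
  let ?y = "adjoint J (e p)"
  have y: "?y \<bullet> e k = J (e k) \<bullet> e p" for k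
    using adjoint_inner[OF J, of "e k" "e p"] by (simp add: inner_commute)
  have "Q ?y \<bullet> ?y = J (Q ?y) \<bullet> e p"
    by (rule adjoint_inner[OF J])
  also have "\<dots> = q p / (1 + c * lam p)"
    by (simp add: cov resolvent_coordinate c Q_basis inner_basis)
  finally show ?thesis
    using inner_sums[of "Q ?y" ?y] by (simp add: Q_sym Q_basis y power2_eq_square ac_simps)
qed

text \<open>Summing the variances of all coordinates by Tonelli: the Hilbert--Schmidt series in question is the
trace of the covariance.\<close>

lemma hilbert_schmidt_if_covariance:
  assumes q: "\<And>p. 0 \<le> q p" and c: "0 < c" and trace: "summable (\<lambda>p. q p / lam p)"
    and cov: "\<And>p. (\<lambda>k. q k * (J (e k) \<bullet> e p)\<^sup>2) sums (q p / (1 + c * lam p))"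
  shows "summable (\<lambda>k. q k * (norm (J (e k)))\<^sup>2)"
proof (rule summable_suminf_not_top)
  have "ennreal (q k * (norm (J (e k)))\<^sup>2) = (\<Sum>p. ennreal (q k * (J (e k) \<bullet> e p)\<^sup>2))" for k
    using q[of k] by (intro suminf_ennreal_eq[symmetric] sums_mult norm_sums) auto
  then have "(\<Sum>k. ennreal (q k * (norm (J (e k)))\<^sup>2)) = (\<Sum>k. \<Sum>p. ennreal (q k * (J (e k) \<bullet> e p)\<^sup>2))"
    by simp
  also have "\<dots> = (\<Sum>p. \<Sum>k. ennreal (q k * (J (e k) \<bullet> e p)\<^sup>2))"
    by (rule ennreal_suminf_swap)
  also have "\<dots> = (\<Sum>p. ennreal (q p / (1 + c * lam p)))"
    using q by (intro suminf_cong suminf_ennreal_eq cov) auto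
  also have "\<dots> \<noteq> \<top>"
  proof (rule ennreal_suminf_neq_top)
    show "0 \<le> q p / (1 + c * lam p)" for p
      using q[of p] c lam_pos[of p] by simp
    show "summable (\<lambda>p. q p / (1 + c * lam p))"
    proof (rule summable_comparison_test'[OF summable_mult[OF trace, of "1 / c"]])
      fix p
      have "q p / (1 + c * lam p) \<le> q p / (c * lam p)"
        using q[of p] c lam_pos[of p] by (intro divide_left_mono) (auto intro!: mult_pos_pos add_pos_pos)
      then show "norm (q p / (1 + c * lam p)) \<le> 1 / c * (q p / lam p)"
        using q[of p] c lam_pos[of p] by simp
    qed
  qed
  finally show "(\<Sum>k. ennreal (q k * (norm (J (e k)))\<^sup>2)) \<noteq> \<top>" .
qed (use q in simp)

lemma resolvent_basis: "0 < c \<Longrightarrow> resolvent D A c (e p) \<bullet> e k = (if p = k then 1 / (1 + c * lam k) else 0)"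
  by (simp add: resolvent_coordinate inner_basis)

lemma resolvent_hilbert_schmidt:
  assumes q: "\<And>p. 0 \<le> q p" and c: "0 < c" and trace: "summable (\<lambda>p. q p / lam p)"
  shows "summable (\<lambda>p. q p * (norm (resolvent D A c (e p)))\<^sup>2)"
proof (rule summable_comparison_test'[OF summable_mult[OF trace, of "1 / c"]])
  fix p
  have cl: "0 < c * lam p"
    using c lam_pos by simp
  have "resolvent D A c (e p) = (1 / (1 + c * lam p)) *\<^sub>R e p"
    by (rule eq_if_coordinates_eq) (simp add: resolvent_basis c inner_basis)
  moreover have "norm (e p) = 1"
    by (simp add: norm_eq_sqrt_inner inner_basis)
  ultimately have "(norm (resolvent D A c (e p)))\<^sup>2 = 1 / (1 + c * lam p)\<^sup>2"
    by (simp add: power_divide)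
  also have "\<dots> \<le> 1 / (c * lam p)"
  proof (rule divide_left_mono)
    have "c * lam p \<le> 1 + 2 * (c * lam p) + (c * lam p)\<^sup>2"
      using cl zero_le_power2[of "c * lam p"] by linarith
    then show "c * lam p \<le> (1 + c * lam p)\<^sup>2"
      by (simp add: power2_sum)
  qed (use cl in \<open>auto intro!: mult_pos_pos zero_less_power add_pos_pos\<close>)
  finally have "q p * (norm (resolvent D A c (e p)))\<^sup>2 \<le> q p * (1 / (c * lam p))"
    using q[of p] by (rule mult_left_mono)
  then show "norm (q p * (norm (resolvent D A c (e p)))\<^sup>2) \<le> 1 / c * (q p / lam p)"
    using q[of p] by simp
qed

end

section \<open>Moment bounds for the scheme and its postprocessing\<close>

theorem proposition3p2:
  fixes A Q F :: "'a::{real_inner, polish_space} \<Rightarrow> 'a"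
    and D :: "'a set"
    and lam q :: "nat \<Rightarrow> real"
    and e :: "nat \<Rightarrow> 'a"
    and M :: "'w measure"
    and \<beta> :: "nat \<Rightarrow> real \<Rightarrow> 'w \<Rightarrow> real"
    and J1 J2 J3 :: "real \<Rightarrow> 'a \<Rightarrow> 'a"
    and J2xi J3xi :: "real \<Rightarrow> nat \<Rightarrow> 'w \<Rightarrow> 'a"
    and u ubar :: "real \<Rightarrow> 'a \<Rightarrow> nat \<Rightarrow> 'w \<Rightarrow> 'a"
    and s :: real
  assumes "self_adjoint_on D (\<lambda>x. - A x)"
    and "complete_orthonormal e"
    and "\<And>p. e p \<in> D"
    and "\<And>p. A (e p) = - lam p *\<^sub>R e p"
    and "0 < lam 0" and "incseq lam" and "filterlim lam at_top sequentially"
    and "bounded_linear Q"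
    and "\<And>x y. Q x \<bullet> y = x \<bullet> Q y"
    and "\<And>x. 0 \<le> Q x \<bullet> x"
    and "\<And>p. Q (e p) = q p *\<^sub>R e p"
    and "\<And>p. 0 \<le> q p" and "bounded (range q)"
    and "0 < s_bar lam e Q"
    and "\<exists>L. L-lipschitz_on UNIV F" and "lipschitz_const F < lam 0"
    and "prob_space M"
    and "independent_wiener_processes M \<beta>"
    and J1: "\<And>h. J1 h = resolvent D A h"
    and J2: "\<And>h. J2 h = resolvent D A ((3 - sqrt 2) / 2 * h)"
    and J3: "\<And>h. h \<in> {0<..<1} \<Longrightarrow> bounded_linear (J3 h)"
      "\<And>h x. h \<in> {0<..<1} \<Longrightarrow> J3 h (Q (adjoint (J3 h) x)) = resolvent D A (h / 2) (Q x)"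
    and "\<And>h. J2xi h = apply_xi M q e \<beta> (J2 h) h"
    and "\<And>h. J3xi h = apply_xi M q e \<beta> (J3 h) h"
    and u: "\<And>h u0. u h u0 = scheme F (J1 h) (J2xi h) h u0"
    and ubar: "\<And>h u0 n \<omega>. ubar h u0 n \<omega> = u h u0 n \<omega> + (1/2 * sqrt h) *\<^sub>R J3xi h n \<omega>"
    and "0 \<le> s" and "ereal s < s_bar lam e Q"
  shows "\<exists>C>0. \<forall>h\<in>{0<..<1}. \<forall>u0\<in>H_space lam e s.
    (SUP n. \<integral>\<^sup>+ \<omega>. H_norm lam e s (u h u0 n \<omega>) \<partial>M) \<le> ennreal C * (1 + H_norm lam e s u0) \<and>
    (SUP n. \<integral>\<^sup>+ \<omega>. H_norm lam e s (ubar h u0 n \<omega>) \<partial>M) \<le> ennreal C * (1 + H_norm lam e s u0)"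
proof -
  note q_nonneg = \<open>\<And>p. 0 \<le> q p\<close> and Q_basis = \<open>\<And>p. Q (e p) = q p *\<^sub>R e p\<close>
    and wiener = \<open>independent_wiener_processes M \<beta>\<close>
  interpret prob_space M by fact
  interpret negative_diagonal_operator e D A lam
    by unfold_locales fact+
  obtain s' where s': "s < s'" "s' < 1"
    and "op_trace e (\<lambda>x. frac_power lam e (-1 + s') (Q x)) < \<infinity>"
    using \<open>ereal s < s_bar lam e Q\<close> unfolding s_bar_def less_Sup_iff by auto
  then have "summable (\<lambda>p. lam p powr (-1 + s') * q p)"
    using q_nonneg unfolding op_trace_frac_power[of Q q, OF Q_basis]
    by (intro summable_suminf_not_top) (auto simp: less_top)
  then have powers: "summable (\<lambda>p. lam p powr r * q p)" if "r \<le> -1 + s'" for r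
    using q_nonneg that by (rule summable_lower_power)
  have trace: "summable (\<lambda>p. lam p powr (s - 1) * q p)"
    using s' by (intro powers) simp
  have "lam p powr - 1 * q p = q p / lam p" for p
    using lam_pos[of p] by (simp add: powr_minus_divide)
  moreover have "summable (\<lambda>p. lam p powr - 1 * q p)"
    using s' \<open>0 \<le> s\<close> by (intro powers) simp
  ultimately have trace0: "summable (\<lambda>p. q p / lam p)"
    by (simp only:)
  define T where "T = (\<Sum>p. lam p powr (s - 1) * q p)"
  have T: "0 \<le> T" "(\<Sum>p. ennreal (lam p powr (s - 1) * q p)) = ennreal T"
    using q_nonneg trace unfolding T_def by (auto intro!: suminf_nonneg suminf_ennreal2)
  define L where "L = lipschitz_const F"
  \<comment> \<open>A nonzero vector shows that the supremum defining the Lipschitz constant is taken over a nonempty set.\<close>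
  have "e 0 \<noteq> 0"
    using inner_basis[of 0 0] by auto
  then have L: "0 \<le> L" "L < lam 0" "\<And>x y. norm (F x - F y) \<le> L * norm (x - y)"
    using lipschitz_const_nonneg[OF \<open>\<exists>L. L-lipschitz_on UNIV F\<close>]
      norm_diff_le_lipschitz_const[OF \<open>\<exists>L. L-lipschitz_on UNIV F\<close>] \<open>lipschitz_const F < lam 0\<close>
    unfolding L_def by auto
  interpret dissipative_drift e D A lam F L s T
    using L T(1) s' \<open>0 \<le> s\<close> by unfold_locales auto
  define G where "G = growth_constant"
  have G: "0 \<le> G"
    unfolding G_def by (rule growth_constant_nonneg)
  \<comment> \<open>The factor 2 and the summand \<open>T\<close> account for the postprocessing; the same constant also covers the scheme itself.\<close>
  define C where "C = 1 + (2 * G + 2 * T)"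
  have "sqrt 2 < sqrt 9"
    by (intro real_sqrt_less_mono) simp
  then have b: "0 < (3 - sqrt 2) / 2"
    by simp
  have main: "(\<integral>\<^sup>+ \<omega>. H_norm lam e s (u h u0 n \<omega>) \<partial>M) \<le> ennreal C * (1 + H_norm lam e s u0) \<and>
      (\<integral>\<^sup>+ \<omega>. H_norm lam e s (ubar h u0 n \<omega>) \<partial>M) \<le> ennreal C * (1 + H_norm lam e s u0)"
    if h: "h \<in> {0<..<1}" and u0: "u0 \<in> H_space lam e s" for h u0 n
  proof -
    have h_pos: "0 < h" and bh: "0 < (3 - sqrt 2) / 2 * h" and h2: "0 < h / 2"
      using h b by auto
    interpret N2: wiener_noise M \<beta> q e h "J2 h"
    proof (intro wiener_noise.intro wiener_noise_axioms.intro)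
      show "bounded_linear (J2 h)"
        unfolding J2 by (rule bounded_linear_resolvent[OF bh])
      show "summable (\<lambda>p. q p * (norm (J2 h (e p)))\<^sup>2)"
        unfolding J2 by (rule resolvent_hilbert_schmidt[OF q_nonneg bh trace0])
    qed (rule prob_space_axioms wiener q_nonneg h_pos)+
    have cov: "(\<lambda>k. q k * (J3 h (e k) \<bullet> e p)\<^sup>2) sums (q p / (1 + h / 2 * lam p))" for p
      by (rule covariance_coordinates[OF J3(1)[OF h] \<open>\<And>x y. Q x \<bullet> y = x \<bullet> Q y\<close> Q_basis h2 J3(2)[OF h]])
    interpret N3: wiener_noise M \<beta> q e h "J3 h"
      by (intro wiener_noise.intro wiener_noise_axioms.intro)
        (rule prob_space_axioms wiener q_nonneg h_pos J3(1)[OF h] hilbert_schmidt_if_covariance[OF q_nonneg h2 trace0 cov])+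
    have norm_e: "norm (e p) \<le> 1" for p
      by (simp add: norm_eq_sqrt_inner inner_basis)
    have X2: "J2xi h = apply_xi M q e \<beta> (J2 h) h" and X3: "J3xi h = apply_xi M q e \<beta> (J3 h) h"
      by fact+
    interpret S: noisy_scheme e D A lam F L s T M h q "normalized_increment \<beta> h" "J2xi h"
    proof unfold_locales
      show "(\<Sum>p. ennreal (lam p powr (s - 1) * q p)) \<le> ennreal T"
        by (simp only: T(2) order_refl)
      show "J2xi h n \<in> borel_measurable M" for n
        unfolding X2 by measurable
      show "orthonormal_variables (\<lambda>n. normalized_increment \<beta> h n p)" for p
        using wiener h_pos by (intro orthonormal_in_time) (auto simp: independent_wiener_processes_def)
      show "AE \<omega> in M. J2xi h n \<omega> \<bullet> e p
          = 1 / (1 + (3 - sqrt 2) / 2 * h * lam p) * sqrt (q p) * normalized_increment \<beta> h n p \<omega>" for n p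
        unfolding X2
        by (rule N2.apply_xi_coordinate_AE[OF _ norm_e]) (unfold J2, rule resolvent_basis[OF bh])
    qed (use q_nonneg h_pos in auto)
    have [measurable]: "J3xi h n \<in> borel_measurable M"
      unfolding X3 by measurable
    obtain r where r: "0 \<le> r" "H_norm lam e s u0 = ennreal r" "sobolev_sq lam e s u0 = ennreal (r\<^sup>2)"
      using sobolev_sq_of_H_space[OF u0] by blast
    have K: "1 \<le> 1 + r" and sq: "1 + r\<^sup>2 \<le> (1 + r)\<^sup>2"
      using r(1) by (auto simp: power2_sum)
    have u_eq: "u h u0 n = scheme F S.J (J2xi h) h u0 n"
      by (simp add: u J1)
    have [measurable]: "u h u0 n \<in> borel_measurable M"
      unfolding u_eq by measurable
    have "(\<integral>\<^sup>+ \<omega>. sobolev_sq lam e s (u h u0 n \<omega>) \<partial>M)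
        \<le> 2 * ennreal (r\<^sup>2) + ennreal (2 * (lam 0 powr (s - 1) * force_moment u0 / lam 0) + T)"
      using S.scheme_sobolev_moment[of u0 n] by (simp only: u_eq r(3))
    also have "\<dots> = ennreal (2 * r\<^sup>2 + (2 * (lam 0 powr (s - 1) * force_moment u0 / lam 0) + T))"
    proof -
      have k: "0 \<le> 2 * (lam 0 powr (s - 1) * force_moment u0 / lam 0) + T"
        using force_moment_nonneg lam_0_pos T(1) by simp
      show ?thesis
        by (subst ennreal_plus[OF _ k]) (auto simp: ennreal_mult)
    qed
    also have "\<dots> \<le> ennreal (G * (1 + r\<^sup>2))"
      unfolding G_def using r(3) by (intro ennreal_leI force_moment_growth) auto
    also have "\<dots> \<le> ennreal (G * (1 + r)\<^sup>2)"
      by (intro ennreal_leI mult_left_mono sq G)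
    finally have u_sob: "(\<integral>\<^sup>+ \<omega>. sobolev_sq lam e s (u h u0 n \<omega>) \<partial>M) \<le> ennreal (G * (1 + r)\<^sup>2)" .
    have J3_sob: "(\<integral>\<^sup>+ \<omega>. sobolev_sq lam e s ((1/2 * sqrt h) *\<^sub>R J3xi h n \<omega>) \<partial>M) \<le> ennreal (1 * T)"
    proof (rule S.sobolev_moment_le)
      fix p
      have l: "0 < lam p" by (rule lam_pos)
      let ?v = "q p / (1 + h / 2 * lam p)"
      \<comment> \<open>The prescribed covariance controls this coordinate for every admissible choice of \<open>J\<^sub>3\<close>.\<close>
      have "(\<Sum>k<N. q k * (J3 h (e k) \<bullet> e p)\<^sup>2) \<le> ?v" for N
        using sum_le_suminf[OF sums_summable[OF cov[of p]], of "{..<N}"] q_nonneg sums_unique[OF cov[of p]]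
        by simp
      then have "(\<integral>\<^sup>+ \<omega>. ennreal ((J3xi h n \<omega> \<bullet> e p)\<^sup>2) \<partial>M) \<le> ennreal (2 * ?v)"
        unfolding X3 by (rule N3.apply_xi_second_moment_le[OF norm_e])
      then have "ennreal (h / 4) * (\<integral>\<^sup>+ \<omega>. ennreal ((J3xi h n \<omega> \<bullet> e p)\<^sup>2) \<partial>M)
          \<le> ennreal (h / 4) * ennreal (2 * ?v)"
        by (intro mult_left_mono) auto
      also have "\<dots> \<le> ennreal (1 * (q p / lam p))"
      proof -
        have "0 < h / 2 * lam p"
          using h2 l by simp
        then have "h / 2 * ?v \<le> h / 2 * (q p / (h / 2 * lam p))"
          using h2 q_nonneg[of p] by (intro mult_left_mono divide_left_mono) auto
        also have "\<dots> = q p / lam p"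
          using h_pos by simp
        finally show ?thesis
          using h_pos by (simp add: ennreal_mult'[symmetric] ennreal_leI)
      qed
      finally have "ennreal (h / 4) * (\<integral>\<^sup>+ \<omega>. ennreal ((J3xi h n \<omega> \<bullet> e p)\<^sup>2) \<partial>M)
          \<le> ennreal (1 * (q p / lam p))" .
      moreover have "(((1/2 * sqrt h) *\<^sub>R J3xi h n \<omega>) \<bullet> e p)\<^sup>2 = h / 4 * (J3xi h n \<omega> \<bullet> e p)\<^sup>2" for \<omega>
        using h_pos by (simp add: power_mult_distrib power_divide)
      ultimately show "(\<integral>\<^sup>+ \<omega>. ennreal ((((1/2 * sqrt h) *\<^sub>R J3xi h n \<omega>) \<bullet> e p)\<^sup>2) \<partial>M)
          \<le> ennreal (1 * (q p / lam p))"
        using h_pos by (simp only: ennreal_mult') (subst nn_integral_cmult; simp)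
    qed simp_all
    have ubar_fun: "ubar h u0 n = (\<lambda>\<omega>. u h u0 n \<omega> + (1/2 * sqrt h) *\<^sub>R J3xi h n \<omega>)"
      by (rule ext) (rule ubar)
    have [measurable]: "ubar h u0 n \<in> borel_measurable M"
      unfolding ubar_fun by measurable
    have "(\<integral>\<^sup>+ \<omega>. sobolev_sq lam e s (ubar h u0 n \<omega>) \<partial>M)
        \<le> (\<integral>\<^sup>+ \<omega>. 2 * sobolev_sq lam e s (u h u0 n \<omega>)
            + 2 * sobolev_sq lam e s ((1/2 * sqrt h) *\<^sub>R J3xi h n \<omega>) \<partial>M)"
      unfolding ubar by (intro nn_integral_mono sobolev_sq_add_le)
    also have "\<dots> = 2 * (\<integral>\<^sup>+ \<omega>. sobolev_sq lam e s (u h u0 n \<omega>) \<partial>M)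
        + 2 * (\<integral>\<^sup>+ \<omega>. sobolev_sq lam e s ((1/2 * sqrt h) *\<^sub>R J3xi h n \<omega>) \<partial>M)"
      by (simp add: nn_integral_add nn_integral_cmult)
    also have "\<dots> \<le> 2 * ennreal (G * (1 + r)\<^sup>2) + 2 * ennreal (1 * T)"
      by (intro add_mono mult_left_mono u_sob J3_sob) auto
    also have "\<dots> = ennreal (2 * (G * (1 + r)\<^sup>2) + 2 * T)"
      using G T(1) by (subst ennreal_plus) (auto simp: ennreal_mult)
    also have "\<dots> \<le> ennreal ((2 * G + 2 * T) * (1 + r)\<^sup>2)"
    proof (rule ennreal_leI)
      have "T * 1 \<le> T * (1 + r)\<^sup>2"
        using T(1) r(1) by (intro mult_left_mono one_le_power) auto
      then show "2 * (G * (1 + r)\<^sup>2) + 2 * T \<le> (2 * G + 2 * T) * (1 + r)\<^sup>2"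
        by (simp only: distrib_right mult.assoc mult_1_right)
    qed
    finally have ubar_sob: "(\<integral>\<^sup>+ \<omega>. sobolev_sq lam e s (ubar h u0 n \<omega>) \<partial>M)
        \<le> ennreal ((2 * G + 2 * T) * (1 + r)\<^sup>2)" .
    have u_sob': "(\<integral>\<^sup>+ \<omega>. sobolev_sq lam e s (u h u0 n \<omega>) \<partial>M) \<le> ennreal ((2 * G + 2 * T) * (1 + r)\<^sup>2)"
      using G T(1) by (intro order_trans[OF u_sob] ennreal_leI mult_right_mono) auto
    have GT: "0 \<le> 2 * G + 2 * T"
      using G T(1) by simp
    have "ennreal ((1 + (2 * G + 2 * T)) * (1 + r)) = ennreal C * (1 + H_norm lam e s u0)"
      using r(1,2) GT unfolding C_def by (subst ennreal_mult) (auto simp: ennreal_plus)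
    then show ?thesis
      using expected_H_norm_le[OF _ K GT u_sob'] expected_H_norm_le[OF _ K GT ubar_sob] by simp
  qed
  have "0 < C"
    using G T(1) by (simp add: C_def)
  then show ?thesis
    using main by (intro exI[of _ C]) (auto intro!: SUP_least)
qed

end
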